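(* Let $n\in\mathbb N$ ($n\ge1$), $s\in(0,1]$, $\gamma>0$ and $1<p<1+\frac2n$. Assume that the initial data $(u_0,u_1)\in(H^s\cap\dot H^{-\gamma})\times(L^2\cap\dot H^{-\gamma})$ satisfy $\widehat{u_0+u_1}\ge0$ and, for some $r>0$, $$\widehat{u_0+u_1}(\xi)>0\quad\text{for a.e. }\xi\in B(r).$$ Then, for all sufficiently small $\varepsilon>0$, the Cauchy problem $$\partial_t^2u+\partial_tu-\Delta u=|u|^p\quad (x\in\mathbb R^n,\ t>0),\qquad u(0,x)=\varepsilon u_0(x),\quad \partial_tu(0,x)=\varepsilon u_1(x)$$ has no global (in time) weak solution. Moreover, there is a constant $C>0$ independent of $\varepsilon$ such that, for all sufficiently small $\varepsilon>0$, the lifespan $T$ of the local solution satisfies $$T\le C\,\varepsilon^{-\frac{p}{p'-1-\frac n2}}.$$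
   Context: All function spaces are on $\mathbb R^n$. $\hat f$ is the Fourier transform, $H^s$ the usual inhomogeneous Sobolev space, $\|f\|_{\dot H^{-\gamma}}:=\||\xi|^{-\gamma}\hat f\|_{L^2}$ and $\dot H^{-\gamma}:=\{f:\|f\|_{\dot H^{-\gamma}}<\infty\}$. $p'$ is the conjugate exponent, $1/p+1/p'=1$. $B(r):=\{\xi\in\mathbb R^n:|\xi|<r\}$. Weak solution: for $0<T\le\infty$, a weak solution on $[0,T)$ is a function $u\in L^p_{\mathrm{loc}}([0,T)\times\mathbb R^n)$ such that for every $\psi\in C_0^\infty([0,T)\times\mathbb R^n)$ $$\int_0^T\!\!\int_{\mathbb R^n}|u|^p\psi\,dx\,dt+\varepsilon\int_{\mathbb R^n}(u_0+u_1)\psi(0,x)\,dx-\varepsilon\int_{\mathbb R^n}u_0\,\partial_t\psi(0,x)\,dx=\int_0^T\!\!\int_{\mathbb R^n}u\,(\partial_t^2-\partial_t-\Delta)\psi\,dx\,dt.$$ It is global if $T=\infty$. The lifespan estimate means that the bound holds for every $T$ such that a weak solution exists on $[0,T)$. *)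

theory Defs
  imports "HOL-Analysis.Analysis"
begin

text \<open>All functions are complex-valued; the real-valued setting is the special case of
  functions with real values.\<close>

section \<open>Fourier transform and Sobolev spaces\<close>

definition square_integrable :: "('a::euclidean_space \<Rightarrow> complex) \<Rightarrow> bool" where
  "square_integrable f \<longleftrightarrow>
     f \<in> borel_measurable lebesgue \<and> integrable lebesgue (\<lambda>x. (norm (f x))\<^sup>2)"

definition truncated_fourier :: "real \<Rightarrow> ('a::euclidean_space \<Rightarrow> complex) \<Rightarrow> 'a \<Rightarrow> complex" where
  "truncated_fourier R f \<xi> =
     complex_of_real ((2 * pi) powr (- real DIM('a) / 2)) *
       (LINT x:cball 0 R|lebesgue. exp (- \<i> * complex_of_real (x \<bullet> \<xi>)) * f x)"

text \<open>The \<open>L\<^sup>2\<close> Fourier transform, as the limit in \<open>L\<^sup>2\<close> of the truncated Fourier integrals.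
  It is a relation because \<open>F\<close> is determined only up to a null set. The limit is taken of
  nonnegative integrals, which are \<open>\<infinity>\<close> (rather than the default value \<open>0\<close>) on divergence.\<close>

definition has_fourier_transform ::
    "('a::euclidean_space \<Rightarrow> complex) \<Rightarrow> ('a \<Rightarrow> complex) \<Rightarrow> bool" where
  "has_fourier_transform f F \<longleftrightarrow>
     square_integrable f \<and> square_integrable F \<and>
     ((\<lambda>R. \<integral>\<^sup>+ \<xi>. ennreal ((norm (truncated_fourier R f \<xi> - F \<xi>))\<^sup>2) \<partial>lebesgue) \<longlongrightarrow> 0) at_top"

definition sobolev :: "real \<Rightarrow> ('a::euclidean_space \<Rightarrow> complex) set" where
  "sobolev s = {f. \<exists>F. has_fourier_transform f F \<and>
     (\<integral>\<^sup>+ \<xi>. ennreal ((1 + (norm \<xi>)\<^sup>2) powr s * (norm (F \<xi>))\<^sup>2) \<partial>lebesgue) < \<infinity>}"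

text \<open>\<open>L\<^sup>2\<close> intersected with the homogeneous Sobolev space of order \<open>-\<gamma>\<close>.\<close>

definition L2_homogeneous_sobolev_neg ::
    "real \<Rightarrow> ('a::euclidean_space \<Rightarrow> complex) set" where
  "L2_homogeneous_sobolev_neg \<gamma> = {f. \<exists>F. has_fourier_transform f F \<and>
     (\<integral>\<^sup>+ \<xi>. ennreal ((norm \<xi> powr (- \<gamma>) * norm (F \<xi>))\<^sup>2) \<partial>lebesgue) < \<infinity>}"

section \<open>Test functions\<close>

definition dir_deriv ::
    "'a::real_normed_vector \<Rightarrow> ('a \<Rightarrow> 'b::real_normed_vector) \<Rightarrow> 'a \<Rightarrow> 'b" where
  "dir_deriv v f z = frechet_derivative f (at z) v"

fun C_k :: "nat \<Rightarrow> ('a::euclidean_space \<Rightarrow> 'b::real_normed_vector) \<Rightarrow> bool" where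
  "C_k 0 f \<longleftrightarrow> continuous_on UNIV f"
| "C_k (Suc k) f \<longleftrightarrow> (\<forall>z. f differentiable (at z)) \<and> (\<forall>b\<in>Basis. C_k k (dir_deriv b f))"

text \<open>A point of space-time is a pair \<open>(t, x)\<close>.\<close>

definition time_strip :: "ereal \<Rightarrow> (real \<times> 'a::euclidean_space) set" where
  "time_strip T = {z. 0 \<le> fst z \<and> ereal (fst z) < T}"

text \<open>The elements of \<open>C\<^sub>0\<^sup>\<infinity>([0,T) \<times> \<real>\<^sup>n)\<close> are the restrictions to \<open>t \<ge> 0\<close> of smooth functions
  on \<open>\<real> \<times> \<real>\<^sup>n\<close> with compact support in \<open>(-\<infinity>,T) \<times> \<real>\<^sup>n\<close>; they need not vanish at \<open>t = 0\<close>.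
  We take these extensions as the test functions: only their values on \<open>t \<ge> 0\<close> enter below.\<close>

definition test_function :: "ereal \<Rightarrow> (real \<times> 'a::euclidean_space \<Rightarrow> complex) \<Rightarrow> bool" where
  "test_function T \<psi> \<longleftrightarrow>
     (\<forall>k. C_k k \<psi>) \<and> compact (closure {z. \<psi> z \<noteq> 0}) \<and>
     (\<forall>z\<in>closure {z. \<psi> z \<noteq> 0}. ereal (fst z) < T)"

definition time_deriv ::
    "(real \<times> 'a::euclidean_space \<Rightarrow> complex) \<Rightarrow> real \<times> 'a \<Rightarrow> complex" where
  "time_deriv \<psi> = dir_deriv (1, 0) \<psi>"

definition laplacian ::
    "(real \<times> 'a::euclidean_space \<Rightarrow> complex) \<Rightarrow> real \<times> 'a \<Rightarrow> complex" where
  "laplacian \<psi> z = (\<Sum>b\<in>Basis. dir_deriv (0, b) (dir_deriv (0, b) \<psi>) z)"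

section \<open>Weak solutions of the damped wave equation\<close>

definition Lp_loc :: "real \<Rightarrow> ereal \<Rightarrow> (real \<times> 'a::euclidean_space \<Rightarrow> complex) \<Rightarrow> bool" where
  "Lp_loc p T u \<longleftrightarrow>
     u \<in> borel_measurable (lebesgue_on (time_strip T)) \<and>
     (\<forall>K. compact K \<and> K \<subseteq> time_strip T \<longrightarrow>
        set_integrable lebesgue K (\<lambda>z. norm (u z) powr p))"

definition weak_solution ::
    "real \<Rightarrow> real \<Rightarrow> ('a::euclidean_space \<Rightarrow> complex) \<Rightarrow> ('a \<Rightarrow> complex) \<Rightarrow> ereal \<Rightarrow>
     (real \<times> 'a \<Rightarrow> complex) \<Rightarrow> bool" where
  "weak_solution p \<epsilon> u0 u1 T u \<longleftrightarrow>
     Lp_loc p T u \<and>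
     (\<forall>\<psi>. test_function T \<psi> \<longrightarrow>
        (LINT z:time_strip T|lebesgue. complex_of_real (norm (u z) powr p) * \<psi> z)
        + complex_of_real \<epsilon> * (LINT x|lebesgue. (u0 x + u1 x) * \<psi> (0, x))
        - complex_of_real \<epsilon> * (LINT x|lebesgue. u0 x * time_deriv \<psi> (0, x))
        = (LINT z:time_strip T|lebesgue.
             u z * (time_deriv (time_deriv \<psi>) z - time_deriv \<psi> z - laplacian \<psi> z)))"

end

theory Submission
  imports Defs "HOL-Probability.Characteristic_Functions" "HOL-Computational_Algebra.Polynomial"
begin

text \<open>Test the equation with \<open>\<psi>\<^sub>R(t,x) = \<Phi>(t/R\<^sup>2) \<Prod>\<^sub>j \<Phi>(x\<^sub>j/R)\<close>, where \<open>\<Phi> = \<chi> * \<chi>\<close> is the autocorrelation of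
  an even smooth bump all of whose derivatives are bounded by multiples of \<open>\<chi>\<^sup>1\<^sup>/\<^sup>p\<close>. The same holds for
  \<open>\<Phi>\<close>, so \<open>\<bar>(\<partial>\<^sub>t\<^sup>2 - \<partial>\<^sub>t - \<Delta>) \<psi>\<^sub>R\<bar> \<le> C R\<^sup>-\<^sup>2 \<psi>\<^sub>R\<^sup>1\<^sup>/\<^sup>p\<close>; and the Fourier transform of \<open>\<Phi>\<close> is a square, so the
  data term, which equals a pairing of the transform of \<open>u0 + u1\<close> with a nonnegative function, is
  nonnegative. Hence the mass \<open>M(R) = \<integral>\<integral> \<bar>u\<bar>\<^sup>p \<psi>\<^sub>R\<close> is at most a multiple of \<open>R\<close> to the power
  \<open>n + 2 - 2p'\<close>. For \<open>R = 1\<close> the data term is a positive multiple of \<open>\<epsilon>\<close>, which forces \<open>M(1) \<ge> c \<epsilon>\<^sup>p\<close>. As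
  \<open>\<psi>\<^sub>1 \<le> C \<psi>\<^sub>R\<close> for large \<open>R\<close>, comparing the two bounds limits \<open>R\<^sup>2 < T\<close>. The factor \<open>p\<close> in the lifespan
  exponent comes from the nonlinearity acting as a source of mass \<open>\<epsilon>\<^sup>p\<close> instead of \<open>\<epsilon>\<close>.\<close>

section \<open>Flat functions and a smooth bump\<close>

text \<open>Letting a polynomial in 1/x multiply the standard flat function exp (-1/x) gives a class
  closed under differentiation, so all derivatives are treated at once.\<close>

definition flat :: "real poly \<Rightarrow> real \<Rightarrow> real" where
  "flat P x = (if 0 < x then poly P (1 / x) * exp (- 1 / x) else 0)"

text \<open>Induction along the Horner form, with the rate \<open>c\<close> generalized: half of the
  rate absorbs the extra factor y, the other half is left for the remaining polynomial.\<close>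

lemma poly_le_exp:
  fixes P :: "real poly"
  assumes "0 < c"
  shows "\<exists>K\<ge>0. \<forall>y\<ge>0. \<bar>poly P y\<bar> \<le> K * exp (c * y)"
  using assms
proof (induction P arbitrary: c)
  case 0
  then show ?case by (intro exI[of _ 0]) auto
next
  case (pCons a Q)
  obtain K where K: "K \<ge> 0" "\<And>y. y \<ge> 0 \<Longrightarrow> \<bar>poly Q y\<bar> \<le> K * exp (c / 2 * y)"
    using pCons.IH[of "c / 2"] pCons.prems by auto
  have "\<bar>poly (pCons a Q) y\<bar> \<le> (\<bar>a\<bar> + 2 / c * K) * exp (c * y)" if y: "y \<ge> 0" for y
  proof -
    have "c / 2 * y \<le> exp (c / 2 * y)"
      using exp_ge_add_one_self[of "c / 2 * y"] by linarith
    then have "y \<le> 2 / c * exp (c / 2 * y)"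
      using pCons.prems by (simp add: field_simps)
    then have "y * \<bar>poly Q y\<bar> \<le> (2 / c * exp (c / 2 * y)) * (K * exp (c / 2 * y))"
      using K y pCons.prems by (intro mult_mono) auto
    also have "\<dots> = 2 / c * K * exp (c * y)"
      by (simp add: mult_exp_exp field_simps)
    finally have 1: "y * \<bar>poly Q y\<bar> \<le> 2 / c * K * exp (c * y)" .
    have "\<bar>a\<bar> * 1 \<le> \<bar>a\<bar> * exp (c * y)"
      using y pCons.prems by (intro mult_left_mono) auto
    moreover have "\<bar>poly (pCons a Q) y\<bar> \<le> \<bar>a\<bar> + y * \<bar>poly Q y\<bar>"
      using y by (simp add: abs_mult order_trans[OF abs_triangle_ineq])
    ultimately show ?thesis
      using 1 by (simp add: algebra_simps)
  qed
  then show ?case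
    using K(1) pCons.prems by (intro exI[of _ "\<bar>a\<bar> + 2 / c * K"]) auto
qed

text \<open>Writing exp (-1/x) as exp (-q/x) times exp (-(1-q)/x), the second factor beats every
  polynomial in 1/x because q < 1.\<close>

lemma flat_le_powr:
  assumes "0 \<le> q" "q < 1"
  shows "\<exists>K\<ge>0. \<forall>x. \<bar>flat P x\<bar> \<le> K * flat 1 x powr q"
proof -
  obtain K where K: "K \<ge> 0" "\<And>y. y \<ge> 0 \<Longrightarrow> \<bar>poly P y\<bar> \<le> K * exp ((1 - q) * y)"
    using poly_le_exp[of "1 - q" P] assms by auto
  have "\<bar>flat P x\<bar> \<le> K * flat 1 x powr q" for x
  proof (cases "0 < x")
    case True
    have "\<bar>poly P (1 / x)\<bar> * exp (- 1 / x) \<le> K * exp ((1 - q) * (1 / x)) * exp (- 1 / x)"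
      using K(2)[of "1 / x"] True by (intro mult_right_mono) auto
    also have "\<dots> = K * exp (- q / x)"
      using True by (simp add: mult_exp_exp diff_divide_distrib)
    also have "exp (- q / x) = flat 1 x powr q"
      using True by (simp add: flat_def powr_def)
    finally show ?thesis
      using True by (simp add: flat_def abs_mult)
  qed (use K in \<open>auto simp: flat_def\<close>)
  with K(1) show ?thesis by blast
qed

text \<open>With y = 1/x one has dy/dx = -y^2, so P(y) exp (-y) has derivative y^2 (P - P')(y) exp
  (-y). Only x = 0 needs an estimate.\<close>

lemma flat_has_derivative:
  "(flat P has_field_derivative flat ([:0, 0, 1:] * (P - pderiv P)) x) (at x)"
proof -
  consider "x > 0" | "x < 0" | "x = 0" by linarith
  then show ?thesis
  proof cases
    case 1
    have "((\<lambda>x. poly P (1 / x) * exp (- 1 / x)) has_field_derivative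
        flat ([:0, 0, 1:] * (P - pderiv P)) x) (at x)"
      using 1 by (auto intro!: derivative_eq_intros DERIV_chain'[OF _ poly_DERIV, of "\<lambda>x. 1 / x"]
          simp: flat_def field_simps power2_eq_square)
    then show ?thesis
      by (rule has_field_derivative_transform_within_open[of _ _ _ "{0<..}"])
        (use 1 in \<open>auto simp: flat_def\<close>)
  next
    case 2
    have "((\<lambda>x. 0) has_field_derivative 0) (at x)" by auto
    then have "(flat P has_field_derivative 0) (at x)"
      by (rule has_field_derivative_transform_within_open[of _ _ _ "{..<0}"])
        (use 2 in \<open>auto simp: flat_def\<close>)
    with 2 show ?thesis by (simp add: flat_def)
  next
    case 3
    \<comment> \<open>The exponent 0 yields a plain constant bound. Moving y^2 into the polynomial
      writes \<open>flat P h / h\<close> as h times a bounded function, so the difference quotient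
      tends to 0.\<close>
    obtain K where K: "\<And>x. \<bar>flat ([:0, 0, 1:] * P) x\<bar> \<le> K * flat 1 x powr 0"
      using flat_le_powr[of 0 "[:0, 0, 1:] * P"] by auto
    have quot: "\<bar>flat P h / h\<bar> \<le> \<bar>K\<bar> * \<bar>h\<bar>" for h
    proof (cases "h > 0")
      case True
      have "flat P h / h = h * flat ([:0, 0, 1:] * P) h"
        using True by (simp add: flat_def field_simps power2_eq_square)
      moreover have "\<bar>flat ([:0, 0, 1:] * P) h\<bar> \<le> \<bar>K\<bar>"
        using K[of h] True by (simp add: flat_def split: if_splits)
      ultimately show ?thesis
        using True by (simp add: abs_mult mult.commute mult_left_mono)
    next
      case False
      then have "flat P h / h = 0" by (simp add: flat_def)
      then show ?thesis by (metis abs_ge_zero abs_mult abs_zero)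
    qed
    have "((\<lambda>h. flat P h / h) \<longlongrightarrow> 0) (at 0)"
    proof (rule Lim_null_comparison)
      show "\<forall>\<^sub>F h in at 0. norm (flat P h / h) \<le> \<bar>K\<bar> * \<bar>h\<bar>"
        using quot by (auto simp: abs_divide)
      show "((\<lambda>h. \<bar>K\<bar> * \<bar>h\<bar>) \<longlongrightarrow> 0) (at 0)"
        by (auto intro!: tendsto_eq_intros)
    qed
    then show ?thesis
      using 3 by (simp add: has_field_derivative_iff flat_def)
  qed
qed

section \<open>Derivatives of the bump and their bounds by powers of the bump\<close>

lemma flat_1_nonneg: "0 \<le> flat 1 x"
  by (simp add: flat_def)

inductive_set bump_family :: "(real \<Rightarrow> real) set" where
  prod: "(\<lambda>t. flat P (1/2 + t) * flat Q (1/2 - t)) \<in> bump_family"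
| add: "f \<in> bump_family \<Longrightarrow> g \<in> bump_family \<Longrightarrow> (\<lambda>t. f t + g t) \<in> bump_family"

definition bump :: "real \<Rightarrow> real" where
  "bump t = flat 1 (1/2 + t) * flat 1 (1/2 - t)"

lemma bump_family_deriv:
  "f \<in> bump_family \<Longrightarrow> \<exists>g\<in>bump_family. \<forall>x. (f has_field_derivative g x) (at x)"
proof (induction rule: bump_family.induct)
  case (prod P Q)
  define D :: "real poly \<Rightarrow> real poly" where "D = (\<lambda>P. [:0, 0, 1:] * (P - pderiv P))"
  \<comment> \<open>The inner derivative of 1/2 - t is -1. The sign is moved into the polynomial,
    which keeps the derivative in the family without a closure rule for negation.\<close>
  have neg: "flat (D (- Q)) x = - flat (D Q) x" for Q x
    by (simp add: D_def flat_def pderiv_minus algebra_simps)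
  have D: "(flat P has_field_derivative flat (D P) x) (at x)" for P x
    unfolding D_def by (rule flat_has_derivative)
  have 1: "((\<lambda>t. flat P (1/2 + t)) has_field_derivative flat (D P) (1/2 + x)) (at x)" for P x
    by (rule DERIV_cong[OF DERIV_chain2[OF D]]) (auto intro!: derivative_eq_intros)
  have 2: "((\<lambda>t. flat P (1/2 - t)) has_field_derivative - flat (D P) (1/2 - x)) (at x)" for P x
    by (rule DERIV_cong[OF DERIV_chain2[OF D]]) (auto intro!: derivative_eq_intros)
  show ?case
  proof (intro bexI allI)
    show "((\<lambda>t. flat P (1/2 + t) * flat Q (1/2 - t)) has_field_derivative
        flat (D P) (1/2 + x) * flat Q (1/2 - x) + flat P (1/2 + x) * flat (D (- Q)) (1/2 - x)) (at x)" for x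
      by (rule DERIV_cong[OF DERIV_mult[OF 1 2]]) (simp add: neg)
    show "(\<lambda>x. flat (D P) (1/2 + x) * flat Q (1/2 - x) + flat P (1/2 + x) * flat (D (- Q)) (1/2 - x)) \<in> bump_family"
      by (intro bump_family.intros)
  qed
next
  case (add f g)
  then obtain f' g' where "f' \<in> bump_family" "g' \<in> bump_family"
    "\<And>x. (f has_field_derivative f' x) (at x)" "\<And>x. (g has_field_derivative g' x) (at x)" by blast
  then show ?case
    by (intro bexI[of _ "\<lambda>t. f' t + g' t"]) (auto intro!: DERIV_add bump_family.add)
qed

lemma bump_family_le_powr:
  assumes "0 \<le> q" "q < 1" "f \<in> bump_family"
  shows "\<exists>K\<ge>0. \<forall>x. \<bar>f x\<bar> \<le> K * bump x powr q"
  using assms(3)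
proof (induction rule: bump_family.induct)
  case (prod P Q)
  obtain K L where K: "K \<ge> 0" "\<And>x. \<bar>flat P x\<bar> \<le> K * flat 1 x powr q"
    and L: "L \<ge> 0" "\<And>x. \<bar>flat Q x\<bar> \<le> L * flat 1 x powr q"
    using flat_le_powr[OF assms(1,2)] by metis
  have "\<bar>flat P (1/2 + t) * flat Q (1/2 - t)\<bar> \<le> (K * L) * bump t powr q" for t
  proof -
    have "\<bar>flat P (1/2 + t) * flat Q (1/2 - t)\<bar>
        \<le> (K * flat 1 (1/2 + t) powr q) * (L * flat 1 (1/2 - t) powr q)"
      unfolding abs_mult by (intro mult_mono K L) (auto simp: K)
    also have "\<dots> = (K * L) * bump t powr q"
      by (simp add: bump_def powr_mult flat_1_nonneg)
    finally show ?thesis .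
  qed
  with K(1) L(1) show ?case
    by (intro exI[of _ "K * L"]) auto
next
  case (add f g)
  then obtain K L where "K \<ge> 0" "L \<ge> 0" "\<And>x. \<bar>f x\<bar> \<le> K * bump x powr q"
    "\<And>x. \<bar>g x\<bar> \<le> L * bump x powr q" by blast
  then show ?case
    by (intro exI[of _ "K + L"])
      (auto simp: algebra_simps intro!: order_trans[OF abs_triangle_ineq] add_mono)
qed

lemma bump_in_family: "bump \<in> bump_family"
proof -
  have "bump = (\<lambda>t. flat 1 (1/2 + t) * flat 1 (1/2 - t))"
    by (auto simp: bump_def)
  then show ?thesis using bump_family.prod by metis
qed

lemma bump_nonneg: "0 \<le> bump t"
  by (simp add: bump_def flat_1_nonneg)

lemma bump_even: "bump (- t) = bump t"
  by (simp add: bump_def)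

lemma bump_eq_0: "1/2 \<le> \<bar>t\<bar> \<Longrightarrow> bump t = 0"
  by (auto simp: bump_def flat_def)

lemma bump_0_pos: "0 < bump 0"
  by (simp add: bump_def flat_def)

text \<open>Choice of one derivative operator on \<open>S\<close> and iteration give all derivatives
  as one explicit sequence, to which bounds can be attached order by order.\<close>

lemma derivative_sequence:
  assumes "f \<in> S" and "\<And>f. f \<in> S \<Longrightarrow> \<exists>g\<in>S. \<forall>x. (f has_field_derivative g x) (at x)"
  obtains D where "D 0 = f" "\<And>k::nat. D k \<in> S"
    "\<And>k x. (D k has_field_derivative D (Suc k) x) (at x)"
proof -
  obtain d where d: "\<And>f. f \<in> S \<Longrightarrow> d f \<in> S \<and> (\<forall>x. (f has_field_derivative d f x) (at x))"
    using assms(2) by metis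
  have S: "(d ^^ k) f \<in> S" for k
    by (induction k) (use assms(1) d in auto)
  show thesis
    by (rule that[of "\<lambda>k. (d ^^ k) f"]) (use S d in auto)
qed

lemma bump_derivatives:
  obtains D where "D 0 = bump"
    "\<And>k x. (D k has_field_derivative D (Suc k) x) (at x)"
    "\<And>k q. 0 \<le> q \<Longrightarrow> q < 1 \<Longrightarrow> \<exists>K\<ge>0. \<forall>x. \<bar>D k x\<bar> \<le> K * bump x powr q"
proof -
  obtain D where "D 0 = bump" "\<And>k::nat. D k \<in> bump_family"
    "\<And>k x. (D k has_field_derivative D (Suc k) x) (at x)"
    using derivative_sequence[OF bump_in_family bump_family_deriv] by metis
  then show thesis
    using that[of D] bump_family_le_powr by blast
qed

lemma continuous_compact_support_integrable:
  fixes f :: "'a::euclidean_space \<Rightarrow> 'b::{banach, second_countable_topology}"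
  assumes "continuous_on UNIV f" and "\<And>x. x \<notin> cbox a b \<Longrightarrow> f x = 0"
  shows "integrable lborel f"
proof -
  have "integrable lborel (\<lambda>x. indicator (cbox a b) x *\<^sub>R f x)"
    by (rule borel_integrable_compact) (auto intro: continuous_on_subset[OF assms(1)])
  also have "(\<lambda>x. indicator (cbox a b) x *\<^sub>R f x) = f"
    using assms(2) by (auto simp: indicator_def)
  finally show ?thesis .
qed

lemma continuous_bump: "continuous_on UNIV bump"
proof -
  obtain D where D: "D 0 = bump" "\<And>k x. (D k has_field_derivative D (Suc k) x) (at x)"
    using bump_derivatives by metis
  then show ?thesis
    by (metis DERIV_isCont continuous_at_imp_continuous_on)
qed

lemma continuous_on_bump [continuous_intros]:
  "continuous_on S f \<Longrightarrow> continuous_on S (\<lambda>x. bump (f x))"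
  by (rule continuous_on_compose2[OF continuous_bump]) auto

lemma continuous_on_of_deriv:
  assumes "\<And>x. (f has_field_derivative g x) (at x)"
  shows "continuous_on UNIV f"
  using assms by (metis DERIV_isCont continuous_at_imp_continuous_on)

lemma integrable_bump: "integrable lborel bump"
  by (rule continuous_compact_support_integrable[OF continuous_bump, of "-1/2" "1/2"])
    (auto simp: bump_eq_0)

section \<open>The autocorrelation of the bump\<close>

definition cutoff :: "real \<Rightarrow> real" where
  "cutoff x = (LINT y|lborel. bump (x - y) * bump y)"

lemma conv_bump_integrable:
  assumes "continuous_on UNIV h"
  shows "integrable lborel (\<lambda>y. h (x - y) * bump y)"
proof (rule continuous_compact_support_integrable[of _ "-1/2" "1/2"])
  show "continuous_on UNIV (\<lambda>y. h (x - y) * bump y)"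
    by (intro continuous_intros continuous_on_compose2[OF assms]) auto
qed (auto simp: bump_eq_0)

text \<open>Differentiation under the integral sign. The support of \<open>bump\<close> reduces the
  integral to a compact interval, where the Leibniz rule asks only for continuity of the
  derivative.\<close>

lemma conv_bump_has_derivative:
  assumes h: "\<And>x. (h has_field_derivative h' x) (at x)" and h': "continuous_on UNIV h'"
  shows "((\<lambda>x. LINT y|lborel. h (x - y) * bump y) has_field_derivative
      (LINT y|lborel. h' (x - y) * bump y)) (at x)"
proof -
  have eq: "(LINT y|lborel. h (x - y) * bump y) = integral (cbox (-1/2) (1/2)) (\<lambda>y. h (x - y) * bump y)"
    if h: "continuous_on UNIV h" for x and h :: "real \<Rightarrow> real"
  proof -
    have "(LINT y|lborel. h (x - y) * bump y) = integral UNIV (\<lambda>y. h (x - y) * bump y)"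
      using conv_bump_integrable[OF h] by (simp add: integral_lborel)
    also have "\<dots> = integral (cbox (-1/2) (1/2)) (\<lambda>y. h (x - y) * bump y)"
      by (subst integral_restrict_UNIV[symmetric])
        (auto intro!: integral_cong simp: bump_eq_0)
    finally show ?thesis .
  qed
  have hc: "continuous_on UNIV h"
    using h by (rule continuous_on_of_deriv)
  have "((\<lambda>x. integral (cbox (-1/2) (1/2)) (\<lambda>y. h (x - y) * bump y)) has_field_derivative
      integral (cbox (-1/2) (1/2)) (\<lambda>y. h' (x - y) * bump y)) (at x within UNIV)"
  proof (rule leibniz_rule_field_derivative)
    show "((\<lambda>x. h (x - y) * bump y) has_field_derivative h' (x - y) * bump y) (at x within UNIV)" for x y
      by (rule DERIV_cmult_right, rule DERIV_cong[OF DERIV_chain2[OF h]]) (auto intro!: derivative_eq_intros)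
    show "(\<lambda>y. h (x - y) * bump y) integrable_on cbox (-1/2) (1/2)" for x
      by (intro integrable_continuous continuous_intros continuous_on_compose2[OF hc]) auto
    show "continuous_on (UNIV \<times> cbox (-1/2) (1/2)) (\<lambda>(x, y). h' (x - y) * bump y)"
      unfolding case_prod_beta
      by (intro continuous_intros continuous_on_compose2[OF h']) auto
  qed auto
  then show ?thesis
    by (simp add: eq[OF hc] eq[OF h'])
qed

lemma cutoff_nonneg: "0 \<le> cutoff x"
  unfolding cutoff_def by (intro integral_nonneg_AE) (auto simp: bump_nonneg)

lemma cutoff_even: "cutoff (- x) = cutoff x"
proof -
  have "cutoff (- x) = (LINT y|lborel. bump (- x + y) * bump y)"
    unfolding cutoff_def
    by (subst lborel_integral_real_affine[of "-1" _ 0]) (auto simp: bump_even)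
  also have "\<dots> = cutoff x"
    unfolding cutoff_def using bump_even[of "x - _"] by (intro Bochner_Integration.integral_cong) auto
  finally show ?thesis .
qed

lemma cutoff_eq_0: assumes "1 \<le> \<bar>x\<bar>" shows "cutoff x = 0"
proof -
  have zero: "bump (x - y) * bump y = 0" for y
  proof -
    have "1/2 \<le> \<bar>y\<bar> \<or> 1/2 \<le> \<bar>x - y\<bar>" using assms by linarith
    then show ?thesis by (auto simp: bump_eq_0)
  qed
  show ?thesis by (simp only: cutoff_def zero) simp
qed

text \<open>The integrand is continuous, nonnegative and equal to \<open>(bump 0)\<^sup>2\<close> at
  y = 0; a vanishing integral would make it vanish on the whole support interval.\<close>

lemma cutoff_0_pos: "0 < cutoff 0"
proof -
  have int: "integrable lborel (\<lambda>y. bump (0 - y) * bump y)"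
    by (rule conv_bump_integrable[OF continuous_bump])
  have "cutoff 0 \<noteq> 0"
  proof
    assume "cutoff 0 = 0"
    then have "integral UNIV (\<lambda>y. bump (0 - y) * bump y) = 0"
      using int by (simp add: cutoff_def integral_lborel)
    moreover have "(\<lambda>y. bump (0 - y) * bump y) integrable_on UNIV"
      using int integrable_on_lborel by blast
    ultimately have "((\<lambda>y. bump (0 - y) * bump y) has_integral 0) UNIV"
      using has_integral_integral by metis
    then have "((\<lambda>y. if y \<in> cbox (-1/2) (1/2) then bump (0 - y) * bump y else 0) has_integral 0) UNIV"
      by (rule has_integral_eq[rotated]) (auto simp: bump_eq_0)
    then have "((\<lambda>y. bump (0 - y) * bump y) has_integral 0) (cbox (-1/2) (1/2))"
      using has_integral_restrict_UNIV by blast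
    then have "bump (0 - 0) * bump 0 = 0"
      by (rule has_integral_0_cbox_imp_0[rotated 2])
        (auto intro!: continuous_intros simp: bump_nonneg box_real mem_box)
    with bump_0_pos show False by simp
  qed
  with cutoff_nonneg[of 0] show ?thesis by simp
qed

text \<open>Integrating \<open>a\<^sup>q \<le> A\<^sup>q (a / A + 1)\<close> against \<open>bump\<close>, with \<open>a = bump (x - y)\<close> and
  \<open>A = cutoff x + \<delta>\<close>, replaces Jensen's inequality.\<close>

lemma conv_bump_powr_le:
  assumes q: "0 < q" "q < 1"
  shows "(LINT y|lborel. bump (x - y) powr q * bump y) \<le> (1 + (LINT y|lborel. bump y)) * cutoff x powr q"
proof -
  let ?m = "LINT y|lborel. bump y"
  have m: "0 \<le> ?m" by (intro integral_nonneg_AE) (auto simp: bump_nonneg)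
  have pw: "a powr q \<le> A powr q * (a / A + 1)" if "0 \<le> a" "0 < A" for a A :: real
  proof -
    have "(a / A) powr q \<le> a / A + 1"
    proof (cases "a / A \<le> 1")
      case True
      then have "(a / A) powr q \<le> 1 powr q" using that q by (intro powr_mono2) auto
      then show ?thesis using that by (simp add: add_increasing)
    next
      case False
      then have "(a / A) powr q \<le> (a / A) powr 1" using that q by (intro powr_mono) auto
      then show ?thesis using that by simp
    qed
    then show ?thesis
      using that by (simp add: powr_divide field_simps)
  qed
  have powr_cont: "continuous_on UNIV (\<lambda>x. bump x powr q)"
    using q by (intro continuous_on_powr' continuous_intros) (auto simp: bump_nonneg)
  have A: "(LINT y|lborel. bump (x - y) powr q * bump y) \<le> (1 + ?m) * A powr q"
    if A: "cutoff x < A" for A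
  proof -
    have A0: "0 < A" using A cutoff_nonneg[of x] by simp
    have "(LINT y|lborel. bump (x - y) powr q * bump y)
        \<le> (LINT y|lborel. A powr q / A * (bump (x - y) * bump y) + A powr q * bump y)"
    proof (rule integral_mono)
      show "bump (x - y) powr q * bump y \<le> A powr q / A * (bump (x - y) * bump y) + A powr q * bump y" for y
        using mult_right_mono[OF pw[OF bump_nonneg[of "x - y"] A0] bump_nonneg[of y]]
        by (simp add: algebra_simps)
    qed (use conv_bump_integrable[OF continuous_bump] conv_bump_integrable[OF powr_cont]
      integrable_bump in auto)
    also have "\<dots> = A powr q * (cutoff x / A) + A powr q * ?m"
      using conv_bump_integrable[OF continuous_bump] integrable_bump by (simp add: cutoff_def)
    also have "\<dots> \<le> A powr q * 1 + A powr q * ?m"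
      using A A0 by (intro add_mono mult_left_mono) auto
    finally show ?thesis by (simp add: algebra_simps)
  qed
  \<comment> \<open>Dividing by \<open>A\<close> needs A > 0. Letting \<open>A\<close> decrease to
    \<open>cutoff x\<close> also covers the points where \<open>cutoff x\<close> is 0.\<close>
  have "((\<lambda>A. (1 + ?m) * A powr q) \<longlongrightarrow> (1 + ?m) * cutoff x powr q) (at_right (cutoff x))"
    by (intro tendsto_intros) (use q cutoff_nonneg[of x] in \<open>auto simp: eventually_at_filter\<close>)
  then show ?thesis
    by (rule tendsto_lowerbound) (use A in \<open>auto simp: eventually_at_filter\<close>)
qed

text \<open>All derivatives are put on the first factor of the convolution. The bound of
  \<open>D k\<close> by a power of \<open>bump\<close> then becomes one by the same power of
  \<open>cutoff\<close> through \<open>conv_bump_powr_le\<close>.\<close>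

lemma cutoff_derivatives:
  obtains G where "G 0 = cutoff"
    "\<And>k x. (G k has_field_derivative G (Suc k) x) (at x)"
    "\<And>k q. 0 < q \<Longrightarrow> q < 1 \<Longrightarrow> \<exists>K\<ge>0. \<forall>x. \<bar>G k x\<bar> \<le> K * cutoff x powr q"
proof (rule bump_derivatives)
  fix D
  assume D: "D 0 = bump" "\<And>k x. (D k has_field_derivative D (Suc k) x) (at x)"
    "\<And>k q. 0 \<le> q \<Longrightarrow> q < 1 \<Longrightarrow> \<exists>K\<ge>0. \<forall>x. \<bar>D k x\<bar> \<le> K * bump x powr q"
  have cont: "continuous_on UNIV (D k)" for k
    using D(2) by (rule continuous_on_of_deriv)
  let ?G = "\<lambda>k x. LINT y|lborel. D k (x - y) * bump y"
  let ?m = "LINT y|lborel. bump y"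
  show thesis
  proof (rule that[of ?G])
    show "?G 0 = cutoff"
      by (simp add: D(1) cutoff_def fun_eq_iff)
    show "(?G k has_field_derivative ?G (Suc k) x) (at x)" for k x
      by (rule conv_bump_has_derivative[OF D(2) cont])
    show "\<exists>K\<ge>0. \<forall>x. \<bar>?G k x\<bar> \<le> K * cutoff x powr q" if q: "0 < q" "q < 1" for k q
    proof -
      obtain K where K: "K \<ge> 0" "\<And>x. \<bar>D k x\<bar> \<le> K * bump x powr q"
        using D(3)[of q k] q by auto
      have powr_cont: "continuous_on UNIV (\<lambda>x. bump x powr q)"
        using q by (intro continuous_on_powr' continuous_intros) (auto simp: bump_nonneg)
      have "\<bar>?G k x\<bar> \<le> K * (1 + ?m) * cutoff x powr q" for x
      proof -
        have "norm (?G k x) \<le> (LINT y|lborel. K * (bump (x - y) powr q * bump y))"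
        proof (rule Bochner_Integration.integral_norm_bound_integral)
          show "norm (D k (x - y) * bump y) \<le> K * (bump (x - y) powr q * bump y)" for y
            using mult_right_mono[OF K(2)[of "x - y"] bump_nonneg[of y]]
            by (simp add: abs_mult bump_nonneg mult.assoc)
        qed (use conv_bump_integrable[OF cont] conv_bump_integrable[OF powr_cont] in auto)
        also have "\<dots> \<le> K * ((1 + ?m) * cutoff x powr q)"
          using conv_bump_powr_le[OF q] K(1) by (simp add: mult_left_mono)
        finally show ?thesis by (simp add: mult.assoc)
      qed
      moreover have "0 \<le> ?m" by (intro integral_nonneg_AE) (auto simp: bump_nonneg)
      ultimately show ?thesis
        using K(1) by (intro exI[of _ "K * (1 + ?m)"]) auto
    qed
  qed
qed

lemma continuous_cutoff: "continuous_on UNIV cutoff"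
  using cutoff_derivatives continuous_on_of_deriv by metis

lemma integrable_cutoff: "integrable lborel cutoff"
  by (rule continuous_compact_support_integrable[OF continuous_cutoff, of "-1" 1])
    (auto simp: cutoff_eq_0)

text \<open>Convolution theorem: after x = y + z the addition formula splits the phase, the sine
  transform of the even bump vanishes, and the square of its cosine transform remains.\<close>

lemma cutoff_cosine_transform_nonneg: "0 \<le> (LINT x|lborel. cos (x * \<xi>) * cutoff x)"
proof -
  let ?c = "LINT z|lborel. cos (z * \<xi>) * bump z"
  have intc: "integrable lborel (\<lambda>z. cos (z * \<xi>) * bump z)"
    and ints: "integrable lborel (\<lambda>z. sin (z * \<xi>) * bump z)"
    by (rule continuous_compact_support_integrable[of _ "-1/2" "1/2"];
      force intro!: continuous_intros simp: bump_eq_0)+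
  have s: "(LINT z|lborel. sin (z * \<xi>) * bump z) = 0"
    using lborel_integral_real_affine[of "-1" "\<lambda>z. sin (z * \<xi>) * bump z" 0] by (simp add: bump_even)
  have "(LINT x|lborel. cos (x * \<xi>) * cutoff x)
      = (LINT x|lborel. LINT y|lborel. cos (x * \<xi>) * (bump (x - y) * bump y))"
    by (simp add: cutoff_def)
  also have "\<dots> = (LINT y|lborel. LINT x|lborel. cos (x * \<xi>) * (bump (x - y) * bump y))"
  proof (rule lborel_pair.Fubini_integral[symmetric])
    have "integrable lborel (\<lambda>(x, y). cos (x * \<xi>) * (bump (x - y) * bump y))"
    \<comment> \<open>Where both bump factors are nonzero, y and x - y lie in (-1/2, 1/2), hence x
      in (-1, 1); so the integrand has compact support and Fubini applies.\<close>
    proof (rule continuous_compact_support_integrable[of _ "(-1, -1/2)" "(1, 1/2)"])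
      show "continuous_on UNIV (\<lambda>(x, y). cos (x * \<xi>) * (bump (x - y) * bump y))"
        unfolding case_prod_beta by (intro continuous_intros)
      fix z :: "real \<times> real" assume "z \<notin> cbox (-1, -1/2) (1, 1/2)"
      moreover obtain x y where "z = (x, y)" by (cases z)
      ultimately have "1 < \<bar>x\<bar> \<or> 1/2 < \<bar>y\<bar>" by (auto simp: cbox_Pair_eq)
      then have "1/2 \<le> \<bar>y\<bar> \<or> 1/2 \<le> \<bar>x - y\<bar>" by linarith
      then show "(case z of (x, y) \<Rightarrow> cos (x * \<xi>) * (bump (x - y) * bump y)) = 0"
        using \<open>z = (x, y)\<close> by (auto simp: bump_eq_0)
    qed
    then show "integrable (lborel \<Otimes>\<^sub>M lborel) (\<lambda>(x, y). cos (x * \<xi>) * (bump (x - y) * bump y))"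
      by (simp add: lborel_prod)
  qed
  also have "\<dots> = (LINT y|lborel. ?c * (cos (y * \<xi>) * bump y))"
  proof (rule Bochner_Integration.integral_cong[OF refl])
    fix y
    have "(LINT x|lborel. cos (x * \<xi>) * (bump (x - y) * bump y))
        = (LINT z|lborel. cos ((y + z) * \<xi>) * (bump z * bump y))"
      by (subst lborel_integral_real_affine[of 1 _ y]) auto
    also have "\<dots> = (LINT z|lborel. (cos (y * \<xi>) * bump y) * (cos (z * \<xi>) * bump z)
        - (sin (y * \<xi>) * bump y) * (sin (z * \<xi>) * bump z))"
      by (intro Bochner_Integration.integral_cong refl) (simp add: cos_add distrib_right algebra_simps)
    also have "\<dots> = ?c * (cos (y * \<xi>) * bump y)"
      using intc ints s by simp
    finally show "(LINT x|lborel. cos (x * \<xi>) * (bump (x - y) * bump y)) = ?c * (cos (y * \<xi>) * bump y)" .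
  qed
  also have "\<dots> = ?c * ?c" by simp
  finally show ?thesis by simp
qed

section \<open>Fourier inversion on the line\<close>

text \<open>This is the real part of the characteristic function of the standard normal
  distribution.\<close>

lemma std_normal_cosine_integral:
  "(LINT z|lborel. cos (t * z) * std_normal_density z) = exp (- (t\<^sup>2) / 2)"
proof -
  have int: "integrable lborel (\<lambda>z. iexp (t * z) * complex_of_real (std_normal_density z))"
    by (rule Bochner_Integration.integrable_bound[of _ std_normal_density])
      (auto simp: norm_mult)
  have "char std_normal_distribution t = (LINT z|lborel. std_normal_density z *\<^sub>R iexp (t * z))"
    unfolding char_def by (subst integral_density) auto
  also have "\<dots> = (LINT z|lborel. iexp (t * z) * complex_of_real (std_normal_density z))"
    by (simp add: scaleR_conv_of_real mult.commute)
  finally have "complex_of_real (exp (- (t\<^sup>2) / 2)) = (LINT z|lborel. iexp (t * z) * complex_of_real (std_normal_density z))"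
    by (simp add: char_std_normal_distribution)
  from arg_cong[OF this, of Re] show ?thesis
    using int by (simp add: integral_Re[symmetric] Re_exp)
qed

lemma gaussian_integrable:
  assumes "0 < \<sigma>"
  shows "integrable lborel (\<lambda>\<xi>::real. exp (- ((\<sigma> * \<xi>)\<^sup>2) / 2))"
proof -
  have "integrable lborel (\<lambda>z. sqrt (2 * pi) * std_normal_density z)"
    by simp
  then have "integrable lborel (\<lambda>z::real. exp (- (z\<^sup>2) / 2))"
    by (simp add: std_normal_density_def)
  from lborel_integrable_real_affine[OF this, of \<sigma> 0] show ?thesis
    using assms by simp
qed

lemma gaussian_cosine_integral:
  assumes "0 < \<sigma>"
  shows "(LINT \<xi>|lborel. cos (a * \<xi>) * exp (- ((\<sigma> * \<xi>)\<^sup>2) / 2))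
      = sqrt (2 * pi) / \<sigma> * exp (- ((a / \<sigma>)\<^sup>2) / 2)"
proof -
  have "exp (- ((a / \<sigma>)\<^sup>2) / 2) = (LINT z|lborel. cos (a / \<sigma> * z) * std_normal_density z)"
    by (rule std_normal_cosine_integral[symmetric])
  also have "\<dots> = \<sigma> * (LINT \<xi>|lborel. cos (a * \<xi>) * std_normal_density (\<sigma> * \<xi>))"
    using assms by (subst lborel_integral_real_affine[of \<sigma> _ 0]) auto
  also have "(\<lambda>\<xi>. cos (a * \<xi>) * std_normal_density (\<sigma> * \<xi>))
      = (\<lambda>\<xi>. 1 / sqrt (2 * pi) * (cos (a * \<xi>) * exp (- ((\<sigma> * \<xi>)\<^sup>2) / 2)))"
    by (auto simp: std_normal_density_def)
  finally show ?thesis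
    using assms by (simp add: field_simps)
qed

section \<open>The cosine transform and its inversion by Gaussian regularization\<close>

lemma (in pair_sigma_finite) integrable_pair_mult:
  fixes f :: "'a \<Rightarrow> 'c::{real_normed_field, banach, second_countable_topology}"
  assumes f: "integrable M1 f" and g: "integrable M2 g"
  shows "integrable (M1 \<Otimes>\<^sub>M M2) (\<lambda>(x, y). f x * g y)"
proof (rule Fubini_integrable)
  have [measurable]: "f \<in> borel_measurable M1" "g \<in> borel_measurable M2"
    using f g by auto
  show "(\<lambda>(x, y). f x * g y) \<in> borel_measurable (M1 \<Otimes>\<^sub>M M2)"
    by measurable
qed (use f g in \<open>auto simp: norm_mult\<close>)

text \<open>For even real functions this is the whole Fourier transform, here without a normalizing
  factor; the inversion argument can thus stay real.\<close>

definition cos_transform :: "(real \<Rightarrow> real) \<Rightarrow> real \<Rightarrow> real" where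
  "cos_transform g \<xi> = (LINT x|lborel. cos (x * \<xi>) * g x)"

lemma cos_mult_integrable:
  "integrable lborel g \<Longrightarrow> integrable lborel (\<lambda>x. cos (x * \<xi>) * (g x :: real))"
  by (rule Bochner_Integration.integrable_bound[of _ g]) (auto simp: abs_mult mult_left_le_one_le)

lemma cos_transform_bound:
  assumes "integrable lborel g"
  shows "\<bar>cos_transform g \<xi>\<bar> \<le> (LINT x|lborel. \<bar>g x\<bar>)"
  using Bochner_Integration.integral_norm_bound_integral[OF cos_mult_integrable[OF assms] integrable_abs[OF assms], of \<xi>]
  by (simp add: cos_transform_def abs_mult mult_left_le_one_le)

lemma cos_transform_measurable:
  assumes "integrable lborel g"
  shows "cos_transform g \<in> borel_measurable borel"
proof -
  have [measurable]: "g \<in> borel_measurable borel" using assms by auto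
  show ?thesis unfolding cos_transform_def by measurable
qed

lemma cos_transform_even: "cos_transform g (- \<xi>) = cos_transform g \<xi>"
  by (simp add: cos_transform_def)

text \<open>The Gaussian weight makes the double integral absolutely convergent. After Fubini the
  frequency integral is again a Gaussian, so the result is an average of \<open>g\<close> near x at
  width \<open>\<sigma>\<close>.\<close>

lemma gaussian_regularized_inversion:
  assumes g: "integrable lborel g" and even: "\<And>x. g (- x) = g x" and \<sigma>: "0 < \<sigma>"
  shows "(LINT \<xi>|lborel. cos (x * \<xi>) * cos_transform g \<xi> * exp (- ((\<sigma> * \<xi>)\<^sup>2) / 2))
    = 2 * pi * (LINT z|lborel. g (x + \<sigma> * z) * std_normal_density z)"
proof -
  let ?w = "\<lambda>\<xi>. exp (- ((\<sigma> * \<xi>)\<^sup>2) / 2)"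
  let ?E = "\<lambda>a. exp (- ((a / \<sigma>)\<^sup>2) / 2)"
  have [measurable]: "g \<in> borel_measurable borel" using g by auto
  have gE: "integrable lborel (\<lambda>y. g y * ?E (x - y))" for x
    by (rule Bochner_Integration.integrable_bound[OF g]) (auto simp: abs_mult mult_left_le)
  have "(LINT \<xi>|lborel. cos (x * \<xi>) * cos_transform g \<xi> * ?w \<xi>)
      = (LINT \<xi>|lborel. LINT y|lborel. (cos (x * \<xi>) * ?w \<xi>) * (cos (y * \<xi>) * g y))"
  proof (rule Bochner_Integration.integral_cong[OF refl])
    fix \<xi>
    show "cos (x * \<xi>) * cos_transform g \<xi> * ?w \<xi> = (LINT y|lborel. (cos (x * \<xi>) * ?w \<xi>) * (cos (y * \<xi>) * g y))"
      unfolding integral_mult_right_zero cos_transform_def by (simp only: mult_ac)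
  qed
  also have "\<dots> = (LINT y|lborel. LINT \<xi>|lborel. (cos (x * \<xi>) * ?w \<xi>) * (cos (y * \<xi>) * g y))"
  proof (rule lborel_pair.Fubini_integral[symmetric])
    show "integrable (lborel \<Otimes>\<^sub>M lborel) (\<lambda>(\<xi>, y). (cos (x * \<xi>) * ?w \<xi>) * (cos (y * \<xi>) * g y))"
    proof (rule Bochner_Integration.integrable_bound)
      show "integrable (lborel \<Otimes>\<^sub>M lborel) (\<lambda>(\<xi>, y). ?w \<xi> * g y)"
        by (rule lborel_pair.integrable_pair_mult[OF gaussian_integrable[OF \<sigma>] g])
      have "\<bar>cos a * w * (cos b * c)\<bar> \<le> \<bar>w * c\<bar>" for a b w c :: real
        using mult_mono[OF mult_mono[OF abs_cos_le_one[of a] abs_cos_le_one[of b]] order_refl, of "\<bar>w * c\<bar>"]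
        by (simp add: abs_mult mult_ac)
      then show "AE z in lborel \<Otimes>\<^sub>M lborel. norm (case z of (\<xi>, y) \<Rightarrow> (cos (x * \<xi>) * ?w \<xi>) * (cos (y * \<xi>) * g y))
          \<le> norm (case z of (\<xi>, y) \<Rightarrow> ?w \<xi> * g y)"
        by (auto simp: case_prod_beta)
    qed measurable
  qed
  \<comment> \<open>The product of the two cosines is half the sum of the cosines of difference and
    sum. The two resulting integrals agree after y is replaced by -y, as \<open>g\<close> is
    even.\<close>
  also have "\<dots> = (LINT y|lborel. sqrt (2 * pi) / \<sigma> * (1/2) * (g y * ?E (x - y) + g y * ?E (x + y)))"
  proof (rule Bochner_Integration.integral_cong[OF refl])
    fix y
    define w where "w = ?w"
    have int: "integrable lborel (\<lambda>\<xi>. cos (a * \<xi>) * w \<xi>)" for a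
      using cos_mult_integrable[OF gaussian_integrable[OF \<sigma>], of a] by (simp add: mult.commute w_def)
    have val: "(LINT \<xi>|lborel. cos (a * \<xi>) * w \<xi>) = sqrt (2 * pi) / \<sigma> * ?E a" for a
      unfolding w_def by (rule gaussian_cosine_integral[OF \<sigma>])
    have "(LINT \<xi>|lborel. (cos (x * \<xi>) * w \<xi>) * (cos (y * \<xi>) * g y))
        = (LINT \<xi>|lborel. (1/2) * g y * (cos ((x - y) * \<xi>) * w \<xi>) + (1/2) * g y * (cos ((x + y) * \<xi>) * w \<xi>))"
      by (intro Bochner_Integration.integral_cong refl)
        (simp add: distrib_right left_diff_distrib cos_add cos_diff algebra_simps)
    also have "\<dots> = (1/2) * g y * (LINT \<xi>|lborel. cos ((x - y) * \<xi>) * w \<xi>) + (1/2) * g y * (LINT \<xi>|lborel. cos ((x + y) * \<xi>) * w \<xi>)"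
      using int by simp
    also have "\<dots> = sqrt (2 * pi) / \<sigma> * (1/2) * (g y * ?E (x - y) + g y * ?E (x + y))"
      unfolding val by (simp add: distrib_left mult_ac)
    finally show "(LINT \<xi>|lborel. (cos (x * \<xi>) * ?w \<xi>) * (cos (y * \<xi>) * g y))
      = sqrt (2 * pi) / \<sigma> * (1/2) * (g y * ?E (x - y) + g y * ?E (x + y))"
      unfolding w_def .
  qed
  also have "\<dots> = sqrt (2 * pi) / \<sigma> * (1/2) * ((LINT y|lborel. g y * ?E (x - y)) + (LINT y|lborel. g y * ?E (x + y)))"
    using gE[of x] lborel_integrable_real_affine[OF gE[of x], of "-1" 0] by (simp add: even)
  also have "(LINT y|lborel. g y * ?E (x + y)) = (LINT y|lborel. g y * ?E (x - y))"
    by (subst lborel_integral_real_affine[of "-1" _ 0]) (auto simp: even)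
  also have "(LINT y|lborel. g y * ?E (x - y)) = \<sigma> * (LINT z|lborel. g (x + \<sigma> * z) * exp (- (z\<^sup>2) / 2))"
    using \<sigma> by (subst lborel_integral_real_affine[of \<sigma> _ x]) auto
  also have "(LINT z|lborel. g (x + \<sigma> * z) * exp (- (z\<^sup>2) / 2))
      = sqrt (2 * pi) * (LINT z|lborel. g (x + \<sigma> * z) * std_normal_density z)"
    by (simp add: std_normal_density_def)
  finally show ?thesis
    using \<sigma> by (simp add: power2_eq_square[symmetric] field_simps real_sqrt_mult_self)
qed

text \<open>The averages concentrate at x as the width shrinks; boundedness of \<open>g\<close>
  supplies the dominating multiple of the normal density.\<close>

lemma regularized_inversion_tendsto:
  assumes g: "continuous_on UNIV g" and bd: "\<And>x. \<bar>g x\<bar> \<le> (M::real)"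
  shows "(\<lambda>k. LINT z|lborel. g (x + 1 / real (Suc k) * z) * std_normal_density z) \<longlonglongrightarrow> g x"
proof -
  have [measurable]: "g \<in> borel_measurable borel" using g by (rule borel_measurable_continuous_onI)
  have "(\<lambda>k. LINT z|lborel. g (x + 1 / real (Suc k) * z) * std_normal_density z)
      \<longlonglongrightarrow> (LINT z|lborel. g x * std_normal_density z)"
  proof (rule integral_dominated_convergence[where w = "\<lambda>z. M * std_normal_density z"])
    show "AE z in lborel. (\<lambda>k. g (x + 1 / real (Suc k) * z) * std_normal_density z) \<longlonglongrightarrow> g x * std_normal_density z"
    proof (intro AE_I2 tendsto_intros)
      fix z
      have "(\<lambda>k. x + 1 / real (Suc k) * z) \<longlonglongrightarrow> x + 0 * z"
        by (intro tendsto_intros LIMSEQ_Suc[OF lim_1_over_n])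
      then show "(\<lambda>k. g (x + 1 / real (Suc k) * z)) \<longlonglongrightarrow> g x"
        using g by (intro continuous_on_tendsto_compose[OF g]) auto
    qed
    show "AE z in lborel. norm (g (x + 1 / real (Suc k) * z) * std_normal_density z) \<le> M * std_normal_density z" for k
      using bd by (auto simp: abs_mult mult_right_mono)
  qed auto
  then show ?thesis by simp
qed

text \<open>Integrability of the transform is a conclusion. As the transform is nonnegative, the
  regularized integrals at x = 0 increase, and their limit 2 pi g(0) is finite, so monotone
  convergence gives it. The transform itself then dominates the integrands at every x.\<close>

lemma fourier_inversion_cos:
  assumes g: "integrable lborel g" and cont: "continuous_on UNIV g"
    and even: "\<And>x. g (- x) = g x" and bd: "\<And>x. \<bar>g x\<bar> \<le> M"
    and nonneg: "\<And>\<xi>. 0 \<le> cos_transform g \<xi>"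
  shows "integrable lborel (cos_transform g)"
    and "(LINT \<xi>|lborel. cos (x * \<xi>) * cos_transform g \<xi>) = 2 * pi * g x"
proof -
  define s where "s = (\<lambda>k. 1 / real (Suc k))"
  have s: "0 < s k" for k by (simp add: s_def)
  have s0: "s \<longlonglongrightarrow> 0" unfolding s_def by (rule LIMSEQ_Suc[OF lim_1_over_n])
  let ?w = "\<lambda>k \<xi>. exp (- ((s k * \<xi>)\<^sup>2) / 2)"
  have [measurable]: "cos_transform g \<in> borel_measurable borel" "g \<in> borel_measurable borel"
    using cos_transform_measurable[OF g] g by auto
  have wlim: "(\<lambda>k. ?w k \<xi>) \<longlonglongrightarrow> 1" for \<xi>
  proof -
    have "(\<lambda>k. ?w k \<xi>) \<longlonglongrightarrow> exp (- ((0 * \<xi>)\<^sup>2) / 2)"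
      by (intro tendsto_intros s0) auto
    then show ?thesis by simp
  qed
  have lim: "(\<lambda>k. LINT \<xi>|lborel. cos (x * \<xi>) * cos_transform g \<xi> * ?w k \<xi>) \<longlonglongrightarrow> 2 * pi * g x" for x
    unfolding gaussian_regularized_inversion[OF g even s]
    unfolding s_def
    by (rule tendsto_mult[OF tendsto_const regularized_inversion_tendsto[OF cont bd]])
  have "integrable lborel (\<lambda>\<xi>. cos_transform g \<xi> * ?w k \<xi>)" for k
  proof (rule Bochner_Integration.integrable_bound)
    show "integrable lborel (\<lambda>\<xi>. (LINT x|lborel. \<bar>g x\<bar>) * ?w k \<xi>)"
      using gaussian_integrable[OF s] by simp
    show "AE \<xi> in lborel. norm (cos_transform g \<xi> * ?w k \<xi>) \<le> norm ((LINT x|lborel. \<bar>g x\<bar>) * ?w k \<xi>)"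
      using cos_transform_bound[OF g] by (auto simp: abs_mult intro!: mult_right_mono)
  qed auto
  \<comment> \<open>The widths \<open>s k\<close> decrease, so the Gaussian weights increase to 1;
    nonnegativity of the transform preserves the monotonicity.\<close>
  moreover have "mono (\<lambda>k. cos_transform g \<xi> * ?w k \<xi>)" for \<xi>
  proof (rule monoI)
    fix j k :: nat assume "j \<le> k"
    then have "s k \<le> s j" by (simp add: s_def frac_le)
    then have "(s k)\<^sup>2 \<le> (s j)\<^sup>2" using s[of k] by (intro power_mono) auto
    then have "(s k * \<xi>)\<^sup>2 \<le> (s j * \<xi>)\<^sup>2" by (simp add: power_mult_distrib mult_right_mono)
    then show "cos_transform g \<xi> * ?w j \<xi> \<le> cos_transform g \<xi> * ?w k \<xi>"
      using nonneg by (intro mult_left_mono) auto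
  qed
  moreover have "(\<lambda>k. cos_transform g \<xi> * ?w k \<xi>) \<longlonglongrightarrow> cos_transform g \<xi>" for \<xi>
    using tendsto_mult[OF tendsto_const[of "cos_transform g \<xi>"] wlim[of \<xi>]] by simp
  moreover have "(\<lambda>k. LINT \<xi>|lborel. cos_transform g \<xi> * ?w k \<xi>) \<longlonglongrightarrow> 2 * pi * g 0"
    using lim[of 0] by simp
  ultimately show int: "integrable lborel (cos_transform g)"
    by (rule integrable_monotone_convergence[where f = "\<lambda>k \<xi>. cos_transform g \<xi> * ?w k \<xi>", OF _ AE_I2 AE_I2])
      auto
  have "(\<lambda>k. LINT \<xi>|lborel. cos (x * \<xi>) * cos_transform g \<xi> * ?w k \<xi>)
      \<longlonglongrightarrow> (LINT \<xi>|lborel. cos (x * \<xi>) * cos_transform g \<xi>)"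
  proof (rule integral_dominated_convergence[where w = "cos_transform g"])
    show "AE \<xi> in lborel. (\<lambda>k. cos (x * \<xi>) * cos_transform g \<xi> * ?w k \<xi>) \<longlonglongrightarrow> cos (x * \<xi>) * cos_transform g \<xi>"
      using tendsto_mult[OF tendsto_const[of "cos (x * _) * cos_transform g _"] wlim] by auto
    show "AE \<xi> in lborel. norm (cos (x * \<xi>) * cos_transform g \<xi> * ?w k \<xi>) \<le> cos_transform g \<xi>" for k
    proof (rule AE_I2)
      fix \<xi>
      have "\<bar>cos (x * \<xi>)\<bar> * cos_transform g \<xi> * ?w k \<xi> \<le> 1 * cos_transform g \<xi> * 1"
        using nonneg by (intro mult_mono) auto
      then show "norm (cos (x * \<xi>) * cos_transform g \<xi> * ?w k \<xi>) \<le> cos_transform g \<xi>"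
        using nonneg by (simp add: abs_mult)
    qed
  qed (use int in auto)
  then show "(LINT \<xi>|lborel. cos (x * \<xi>) * cos_transform g \<xi>) = 2 * pi * g x"
    using lim[of x] by (rule LIMSEQ_unique)
qed

lemma fourier_inversion_exp:
  assumes g: "integrable lborel g" and cont: "continuous_on UNIV g"
    and even: "\<And>x. g (- x) = g x" and bd: "\<And>x. \<bar>g x\<bar> \<le> M"
    and nonneg: "\<And>\<xi>. 0 \<le> cos_transform g \<xi>"
  shows "integrable lborel (\<lambda>\<xi>. exp (- \<i> * complex_of_real (x * \<xi>)) * complex_of_real (cos_transform g \<xi>))"
    and "(LINT \<xi>|lborel. exp (- \<i> * complex_of_real (x * \<xi>)) * complex_of_real (cos_transform g \<xi>))
      = complex_of_real (2 * pi * g x)"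
proof -
  note inv = fourier_inversion_cos[OF assms]
  have [measurable]: "cos_transform g \<in> borel_measurable borel"
    using inv(1) by auto
  show int: "integrable lborel (\<lambda>\<xi>. exp (- \<i> * complex_of_real (x * \<xi>)) * complex_of_real (cos_transform g \<xi>))"
    by (rule Bochner_Integration.integrable_bound[OF inv(1)]) (auto simp: norm_mult)
  \<comment> \<open>The integrand is odd, so only the cosine part of the exponential
    contributes.\<close>
  have "(LINT \<xi>|lborel. sin (x * \<xi>) * cos_transform g \<xi>) = 0"
    using lborel_integral_real_affine[of "-1" "\<lambda>\<xi>. sin (x * \<xi>) * cos_transform g \<xi>" 0]
    by (simp add: cos_transform_even)
  then show "(LINT \<xi>|lborel. exp (- \<i> * complex_of_real (x * \<xi>)) * complex_of_real (cos_transform g \<xi>))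
      = complex_of_real (2 * pi * g x)"
    using inv(2)[of x] int
    by (intro complex_eqI) (simp_all add: integral_Re[symmetric] integral_Im[symmetric] Re_exp Im_exp)
qed

section \<open>Fourier transforms in several variables\<close>

lemma sigma_finite_lebesgue: "sigma_finite_measure (lebesgue :: 'a::euclidean_space measure)"
proof -
  obtain A :: "'a set set" where A: "countable A" "A \<subseteq> sets lborel" "\<Union>A = space lborel"
    "\<forall>a\<in>A. emeasure lborel a \<noteq> \<infinity>"
    using lborel.sigma_finite_countable by blast
  then show ?thesis
    by (intro sigma_finite_measure.intro exI[of _ A]) (auto simp: subset_iff)
qed

text \<open>The data and their transforms are only Lebesgue measurable, so Fubini is applied to the
  product of the completed measures.\<close>

interpretation lebesgue_pair: pair_sigma_finite lebesgue lebesgue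
  by (intro pair_sigma_finite.intro sigma_finite_lebesgue)

lemma
  fixes f :: "'a::euclidean_space \<Rightarrow> real \<Rightarrow> 'c::{real_normed_field, banach, second_countable_topology}"
  assumes f: "\<And>b. b \<in> Basis \<Longrightarrow> integrable lborel (f b)"
  shows integrable_prod_Basis: "integrable lborel (\<lambda>x::'a. \<Prod>b\<in>Basis. f b (x \<bullet> b))"
    and integral_prod_Basis:
      "integral\<^sup>L lborel (\<lambda>x::'a. \<Prod>b\<in>Basis. f b (x \<bullet> b)) = (\<Prod>b\<in>Basis. LINT t|lborel. f b t)"
proof -
  \<comment> \<open>\<open>lborel\<close> is the image of a product of one-dimensional measures
    under the coordinate map, which turns both claims into Fubini for finite products.\<close>
  interpret product_sigma_finite "\<lambda>_::'a. lborel :: real measure" ..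
  let ?M = "\<Pi>\<^sub>M b\<in>(Basis :: 'a set). (lborel :: real measure)"
  let ?e = "\<lambda>g. \<Sum>b\<in>Basis. g b *\<^sub>R b :: 'a"
  have e: "?e \<in> ?M \<rightarrow>\<^sub>M borel" by measurable
  have [measurable]: "f b \<in> borel_measurable borel" if "b \<in> Basis" for b
    using f[OF that] by auto
  have meas: "(\<lambda>x::'a. \<Prod>b\<in>Basis. f b (x \<bullet> b)) \<in> borel_measurable borel"
    by (intro borel_measurable_prod) measurable
  have eq: "(\<Prod>b\<in>Basis. f b (?e g \<bullet> b)) = (\<Prod>b\<in>Basis. f b (g b))" for g
    by (intro prod.cong refl) simp
  show "integrable lborel (\<lambda>x::'a. \<Prod>b\<in>Basis. f b (x \<bullet> b))"
    by (subst lborel_eq, subst integrable_distr_eq[OF e meas])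
      (simp only: eq product_integrable_prod[OF finite_Basis f])
  show "integral\<^sup>L lborel (\<lambda>x::'a. \<Prod>b\<in>Basis. f b (x \<bullet> b)) = (\<Prod>b\<in>Basis. LINT t|lborel. f b t)"
    by (subst lborel_eq, subst integral_distr[OF e meas])
      (simp only: eq product_integral_prod[OF finite_Basis f])
qed

section \<open>Product cutoffs in space and their frequency profiles\<close>

definition cutoff_nd :: "real \<Rightarrow> 'a::euclidean_space \<Rightarrow> real" where
  "cutoff_nd R x = (\<Prod>b\<in>Basis. cutoff (x \<bullet> b / R))"

text \<open>For R > 0 this is the inverse Fourier transform of \<open>cutoff_nd R\<close>: the 1/(2
  pi) in each coordinate cancels the constant of one-dimensional inversion.\<close>

definition cutoff_freq :: "real \<Rightarrow> 'a::euclidean_space \<Rightarrow> real" where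
  "cutoff_freq R \<xi> = (\<Prod>b\<in>Basis. cos_transform (\<lambda>t. cutoff (t / R)) (\<xi> \<bullet> b) / (2 * pi))"

lemma cutoff_bounded: obtains M where "\<And>x. \<bar>cutoff x\<bar> \<le> M"
proof -
  have "compact (cutoff ` {-1..1})"
    by (intro compact_continuous_image continuous_on_subset[OF continuous_cutoff]) auto
  then obtain M where M: "\<And>x. x \<in> {-1..1} \<Longrightarrow> \<bar>cutoff x\<bar> \<le> M"
    using compact_imp_bounded by (force simp: bounded_iff)
  have "\<bar>cutoff x\<bar> \<le> M" for x
    using M[of x] M[of 0] cutoff_eq_0[of x] by (cases "x \<in> {-1..1}") auto
  then show thesis by (rule that)
qed

context
  fixes R :: real
  assumes R: "0 < R"
begin

lemma scaled_cutoff_inversion: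
  shows "integrable lborel (\<lambda>\<xi>. exp (- \<i> * complex_of_real (x * \<xi>)) * complex_of_real (cos_transform (\<lambda>t. cutoff (t / R)) \<xi>))"
    and "(LINT \<xi>|lborel. exp (- \<i> * complex_of_real (x * \<xi>)) * complex_of_real (cos_transform (\<lambda>t. cutoff (t / R)) \<xi>))
      = complex_of_real (2 * pi * cutoff (x / R))"
    and "0 \<le> cos_transform (\<lambda>t. cutoff (t / R)) \<xi>"
    and "integrable lborel (\<lambda>t. cutoff (t / R))"
    and "integrable lborel (cos_transform (\<lambda>t. cutoff (t / R)))"
proof -
  obtain M where M: "\<And>x. \<bar>cutoff x\<bar> \<le> M" using cutoff_bounded by blast
  show int: "integrable lborel (\<lambda>t. cutoff (t / R))"
    using lborel_integrable_real_affine[OF integrable_cutoff, of "1 / R" 0] R by simp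
  have cont: "continuous_on UNIV (\<lambda>t. cutoff (t / R))"
    using R by (intro continuous_on_compose2[OF continuous_cutoff] continuous_intros) auto
  have nn: "0 \<le> cos_transform (\<lambda>t. cutoff (t / R)) \<xi>" for \<xi>
  proof -
    have "cos_transform (\<lambda>t. cutoff (t / R)) \<xi> = R * (LINT x|lborel. cos (x * (R * \<xi>)) * cutoff x)"
      unfolding cos_transform_def using R
      by (subst lborel_integral_real_affine[of R _ 0]) (auto simp: mult_ac)
    then show ?thesis using R cutoff_cosine_transform_nonneg by simp
  qed
  show "0 \<le> cos_transform (\<lambda>t. cutoff (t / R)) \<xi>" by (rule nn)
  have even: "cutoff (- x / R) = cutoff (x / R)" for x
    using cutoff_even[of "x / R"] by simp
  show "integrable lborel (cos_transform (\<lambda>t. cutoff (t / R)))"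
    by (rule fourier_inversion_cos(1)[OF int cont even M nn])
  show "integrable lborel (\<lambda>\<xi>. exp (- \<i> * complex_of_real (x * \<xi>)) * complex_of_real (cos_transform (\<lambda>t. cutoff (t / R)) \<xi>))"
    by (rule fourier_inversion_exp(1)[OF int cont even M nn])
  show "(LINT \<xi>|lborel. exp (- \<i> * complex_of_real (x * \<xi>)) * complex_of_real (cos_transform (\<lambda>t. cutoff (t / R)) \<xi>))
      = complex_of_real (2 * pi * cutoff (x / R))"
    by (rule fourier_inversion_exp(2)[OF int cont even M nn])
qed

lemma cutoff_freq_nonneg: "0 \<le> cutoff_freq R \<xi>"
  unfolding cutoff_freq_def by (intro prod_nonneg) (simp add: scaled_cutoff_inversion(3))

lemma cutoff_freq_integrable: "integrable lborel (cutoff_freq R :: 'a::euclidean_space \<Rightarrow> real)"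
  unfolding cutoff_freq_def
  using scaled_cutoff_inversion(5) by (intro integrable_prod_Basis) simp

text \<open>Bounded and integrable together give square integrable, as needed for the pairing with
  an L2 transform.\<close>

lemma cutoff_freq_bounded: "\<exists>B. \<forall>\<xi>::'a::euclidean_space. cutoff_freq R \<xi> \<le> B"
proof -
  let ?M = "(LINT t|lborel. \<bar>cutoff (t / R)\<bar>) / (2 * pi)"
  have "cutoff_freq R \<xi> \<le> (\<Prod>b\<in>(Basis::'a set). ?M)" for \<xi> :: 'a
    unfolding cutoff_freq_def
    using cos_transform_bound[OF scaled_cutoff_inversion(4)]
    by (intro prod_mono) (auto simp: scaled_cutoff_inversion(3) intro!: divide_right_mono dest: abs_le_D1)
  then show ?thesis by blast
qed

lemma cutoff_nd_eq_integral:
  fixes x :: "'a::euclidean_space"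
  shows "(LINT \<xi>|lborel. exp (- \<i> * complex_of_real (x \<bullet> \<xi>)) * complex_of_real (cutoff_freq R \<xi>))
    = complex_of_real (cutoff_nd R x)"
proof -
  let ?g = "\<lambda>b t. exp (- \<i> * complex_of_real ((x \<bullet> b) * t)) * complex_of_real (cos_transform (\<lambda>t. cutoff (t / R)) t) / (2 * pi)"
  \<comment> \<open>The exponential of an inner product factors over the coordinates, which leaves
    one inversion on the line per coordinate.\<close>
  have "exp (- \<i> * complex_of_real (x \<bullet> \<xi>)) * complex_of_real (cutoff_freq R \<xi>) = (\<Prod>b\<in>Basis. ?g b (\<xi> \<bullet> b))" for \<xi> :: 'a
  proof -
    have "exp (- \<i> * complex_of_real (x \<bullet> \<xi>)) = (\<Prod>b\<in>Basis. exp (- \<i> * complex_of_real ((x \<bullet> b) * (\<xi> \<bullet> b))))"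
      by (subst euclidean_inner) (simp add: exp_sum sum_distrib_left sum_negf[symmetric])
    then show ?thesis
      unfolding cutoff_freq_def by (simp add: prod.distrib prod_dividef)
  qed
  then have "(LINT \<xi>|lborel. exp (- \<i> * complex_of_real (x \<bullet> \<xi>)) * complex_of_real (cutoff_freq R \<xi>))
      = (LINT \<xi>|lborel. (\<Prod>b\<in>Basis. ?g b (\<xi> \<bullet> b)))"
    by (simp only:)
  also have "\<dots> = (\<Prod>b\<in>Basis. LINT t|lborel. ?g b t)"
    by (rule integral_prod_Basis) (intro integrable_divide scaled_cutoff_inversion(1))
  also have "\<dots> = complex_of_real (cutoff_nd R x)"
    unfolding cutoff_nd_def integral_divide_zero scaled_cutoff_inversion(2)
    by simp
  finally show ?thesis .
qed

end

text \<open>On the support of \<open>cutoff\<close> and for frequencies below 1 the phase stays in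
  [-1, 1], where the cosine is at least cos 1 > 0.\<close>

lemma cutoff_freq_pos_near_0:
  fixes \<xi> :: "'a::euclidean_space"
  assumes "norm \<xi> < 1"
  shows "0 < cutoff_freq 1 \<xi>"
proof -
  have int: "integrable lborel (\<lambda>t. cutoff t)" using integrable_cutoff by simp
  \<comment> \<open>A zero integral would make the whole transform vanish, contradicting the
    inversion formula at 0, whose value is 2 pi times \<open>cutoff 0\<close>.\<close>
  have pos: "0 < (LINT t|lborel. cutoff t)"
  proof (rule ccontr)
    assume "\<not> 0 < (LINT t|lborel. cutoff t)"
    then have "cos_transform cutoff \<xi> = 0" for \<xi>
      using cos_transform_bound[OF integrable_cutoff, of \<xi>] by (simp add: cutoff_nonneg)
    then show False
      using scaled_cutoff_inversion(2)[of 1 0] cutoff_0_pos by simp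
  qed
  have "0 < cos_transform cutoff s" if s: "\<bar>s\<bar> < 1" for s
  proof -
    have "(LINT t|lborel. cos 1 * cutoff t) \<le> (LINT t|lborel. cos (t * s) * cutoff t)"
    proof (rule integral_mono)
      fix t
      show "cos 1 * cutoff t \<le> cos (t * s) * cutoff t"
      proof (cases "\<bar>t\<bar> < 1")
        case True
        have "\<bar>t * s\<bar> \<le> 1" using True s by (simp add: abs_mult mult_le_one)
        then have "cos 1 \<le> cos \<bar>t * s\<bar>"
          using pi_gt3 by (intro cos_monotone_0_pi_le) auto
        then show ?thesis by (intro mult_right_mono cutoff_nonneg) simp
      qed (simp add: cutoff_eq_0)
    qed (use int cos_mult_integrable[OF int] in auto)
    moreover have "0 < cos (1::real)" by (rule cos_gt_zero_pi) (use pi_gt3 in auto)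
    ultimately show ?thesis
      using pos by (simp add: cos_transform_def) (smt (verit) mult_pos_pos)
  qed
  moreover have "\<bar>\<xi> \<bullet> b\<bar> < 1" if "b \<in> Basis" for b
    using Basis_le_norm[OF that, of \<xi>] assms by simp
  ultimately show ?thesis
    by (simp add: cutoff_freq_def prod_pos)
qed

text \<open>The multiplication formula for L2 functions. For truncated transforms it is Fubini, and
  the truncation has no effect once the ball contains the support of \<open>\<phi>\<close>;
  Cauchy-Schwarz then carries it to the L2 limit.\<close>

lemma fourier_pairing:
  fixes f F :: "'a::euclidean_space \<Rightarrow> complex" and h :: "'a \<Rightarrow> real"
  assumes ft: "has_fourier_transform f F"
    and h: "integrable lborel h" "\<And>\<xi>. 0 \<le> h \<xi>" "\<And>\<xi>. h \<xi> \<le> B"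
    and \<phi>: "\<And>x. (LINT \<xi>|lborel. exp (- \<i> * complex_of_real (x \<bullet> \<xi>)) * complex_of_real (h \<xi>)) = \<phi> x"
    and supp: "\<And>x. A < norm x \<Longrightarrow> \<phi> x = 0"
  shows "integrable lebesgue (\<lambda>\<xi>. F \<xi> * complex_of_real (h \<xi>))"
    and "(LINT \<xi>|lebesgue. F \<xi> * complex_of_real (h \<xi>))
      = complex_of_real ((2 * pi) powr (- real DIM('a) / 2)) * (LINT x|lebesgue. f x * \<phi> x)"
proof -
  define c where "c = complex_of_real ((2 * pi) powr (- real DIM('a) / 2))"
  have f: "f \<in> borel_measurable lebesgue" "integrable lebesgue (\<lambda>x. (norm (f x))\<^sup>2)"
    and F: "F \<in> borel_measurable lebesgue" "integrable lebesgue (\<lambda>x. (norm (F x))\<^sup>2)"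
    and lim: "((\<lambda>R. \<integral>\<^sup>+ \<xi>. ennreal ((norm (truncated_fourier R f \<xi> - F \<xi>))\<^sup>2) \<partial>lebesgue) \<longlongrightarrow> 0) at_top"
    using ft by (auto simp: has_fourier_transform_def square_integrable_def)
  note [measurable] = f(1) F(1)
  have hb [measurable]: "h \<in> borel_measurable borel" using h(1) by auto
  have \<phi>l: "(LINT \<xi>|lebesgue. exp (- \<i> * complex_of_real (x \<bullet> \<xi>)) * complex_of_real (h \<xi>)) = \<phi> x" for x
    unfolding \<phi>[symmetric] by (rule integral_completion) measurable
  have hl [measurable]: "h \<in> borel_measurable lebesgue"
    using hb by (simp add: measurable_completion)
  have id [measurable]: "(\<lambda>x::'a. x) \<in> lebesgue \<rightarrow>\<^sub>M borel"
    by (simp add: measurable_completion)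
  have hint: "integrable lebesgue h"
    using h(1) hb by (simp add: integrable_completion)
  have h2: "integrable lebesgue (\<lambda>\<xi>. (h \<xi>)\<^sup>2)"
  proof (rule Bochner_Integration.integrable_bound)
    show "integrable lebesgue (\<lambda>\<xi>. B * h \<xi>)" using hint by simp
    show "AE \<xi> in lebesgue. norm ((h \<xi>)\<^sup>2) \<le> norm (B * h \<xi>)"
    proof (rule AE_I2)
      fix \<xi>
      have "(h \<xi>)\<^sup>2 \<le> B * h \<xi>"
        unfolding power2_eq_square using h(2,3) by (intro mult_right_mono)
      then show "norm ((h \<xi>)\<^sup>2) \<le> norm (B * h \<xi>)" by simp
    qed
  qed measurable
  show Fh: "integrable lebesgue (\<lambda>\<xi>. F \<xi> * complex_of_real (h \<xi>))"
  proof (rule Bochner_Integration.integrable_bound)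
    show "integrable lebesgue (\<lambda>\<xi>. (norm (F \<xi>))\<^sup>2 + (h \<xi>)\<^sup>2)" using F h2 by simp
    have "norm (F \<xi>) * h \<xi> \<le> (norm (F \<xi>))\<^sup>2 + (h \<xi>)\<^sup>2" for \<xi>
      using sum_squares_bound[of "norm (F \<xi>)" "h \<xi>"] mult_nonneg_nonneg[OF norm_ge_zero[of "F \<xi>"] h(2)[of \<xi>]] by linarith
    then show "AE \<xi> in lebesgue. norm (F \<xi> * complex_of_real (h \<xi>)) \<le> norm ((norm (F \<xi>))\<^sup>2 + (h \<xi>)\<^sup>2)"
      using h(2) by (auto simp: norm_mult)
  qed measurable
  define J where "J = c * (LINT x|lebesgue. f x * \<phi> x)"
  define I where "I = (LINT \<xi>|lebesgue. F \<xi> * complex_of_real (h \<xi>))"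
  define H where "H = (\<integral>\<^sup>+ \<xi>. ennreal ((h \<xi>)\<^sup>2) \<partial>lebesgue)"
  have Hfin: "H < \<infinity>"
    using h2 unfolding H_def integrable_iff_bounded by (simp add: less_top)
  let ?e = "\<lambda>x \<xi>. exp (- \<i> * complex_of_real (x \<bullet> \<xi>))"
  \<comment> \<open>Neither \<open>J\<close> nor \<open>I\<close> depends on R, so a right side
    tending to 0 proves them equal. Working in \<open>ennreal\<close> avoids integrability of the
    squared difference for each single R.\<close>
  have bound: "ennreal ((norm (J - I))\<^sup>2) \<le>
      (\<integral>\<^sup>+ \<xi>. ennreal ((norm (truncated_fourier R f \<xi> - F \<xi>))\<^sup>2) \<partial>lebesgue) * H" if R: "A \<le> R" for R
  proof -
    define fR where "fR = (\<lambda>x. indicator (cball 0 R) x *\<^sub>R f x)"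
    have fR [measurable]: "fR \<in> borel_measurable lebesgue" unfolding fR_def
      using f(1) by (intro borel_measurable_scaleR borel_measurable_indicator) auto
    have fRint: "integrable lebesgue fR"
    proof (rule Bochner_Integration.integrable_bound)
      show "integrable lebesgue (\<lambda>x. indicator (cball 0 R) x + (norm (f x))\<^sup>2)"
        using f(2) by (intro Bochner_Integration.integrable_add integrable_real_indicator)
          (use emeasure_bounded_finite[of "cball (0::'a) R"] in auto)
      \<comment> \<open>A square integrable function is integrable on sets of finite measure, here
        on the ball.\<close>
      have "norm (f x) \<le> 1 + (norm (f x))\<^sup>2" for x
        using sum_squares_bound[of 1 "norm (f x)"] norm_ge_zero[of "f x"] by (simp only: one_power2)
      then show "AE x in lebesgue. norm (fR x) \<le> norm (indicator (cball 0 R) x + (norm (f x))\<^sup>2)"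
        by (auto simp: fR_def indicator_def)
    qed measurable
    have m1 [measurable]: "(\<lambda>p. fst p \<bullet> snd p) \<in> borel_measurable (lebesgue \<Otimes>\<^sub>M (lebesgue :: 'a measure))"
      by (intro borel_measurable_inner measurable_compose[OF measurable_fst id] measurable_compose[OF measurable_snd id])
    have pair: "integrable (lebesgue \<Otimes>\<^sub>M lebesgue) (\<lambda>(x, \<xi>). ?e x \<xi> * fR x * complex_of_real (h \<xi>))"
    proof (rule Bochner_Integration.integrable_bound)
      show "integrable (lebesgue \<Otimes>\<^sub>M lebesgue) (\<lambda>(x, \<xi>). fR x * complex_of_real (h \<xi>))"
        using fRint hint by (intro lebesgue_pair.integrable_pair_mult) auto
      show "(\<lambda>(x, \<xi>). ?e x \<xi> * fR x * complex_of_real (h \<xi>)) \<in> borel_measurable (lebesgue \<Otimes>\<^sub>M lebesgue)"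
        unfolding case_prod_beta by measurable
    qed (auto simp: norm_mult)
    have tf: "truncated_fourier R f \<xi> = c * (LINT x|lebesgue. ?e x \<xi> * fR x)" for \<xi>
      unfolding truncated_fourier_def set_lebesgue_integral_def c_def fR_def
      by (simp add: scaleR_conv_of_real mult_ac)
    have eint: "integrable lebesgue (\<lambda>x. ?e x \<xi> * fR x)" for \<xi>
      by (rule Bochner_Integration.integrable_bound[OF fRint]) (auto simp: norm_mult)
    have tf_meas [measurable]: "truncated_fourier R f \<in> borel_measurable lebesgue"
      unfolding tf[abs_def]
      by (intro borel_measurable_times borel_measurable_const
          sigma_finite_measure.borel_measurable_lebesgue_integral[OF sigma_finite_lebesgue])
        (simp add: case_prod_beta inner_commute, measurable)
    have TFh: "integrable lebesgue (\<lambda>\<xi>. truncated_fourier R f \<xi> * complex_of_real (h \<xi>))"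
    proof (rule Bochner_Integration.integrable_bound)
      show "integrable lebesgue (\<lambda>\<xi>. norm c * (LINT x|lebesgue. norm (fR x)) * h \<xi>)"
        using hint by simp
      have "norm (LINT x|lebesgue. ?e x \<xi> * fR x) \<le> (LINT x|lebesgue. norm (fR x))" for \<xi>
        by (rule Bochner_Integration.integral_norm_bound_integral)
          (use eint fRint in \<open>auto simp: norm_mult\<close>)
      then show "AE \<xi> in lebesgue. norm (truncated_fourier R f \<xi> * complex_of_real (h \<xi>))
          \<le> norm (norm c * (LINT x|lebesgue. norm (fR x)) * h \<xi>)"
        using h(2) by (auto simp: tf norm_mult abs_mult intro!: mult_mono mult_nonneg_nonneg)
    qed measurable
    have "(LINT \<xi>|lebesgue. truncated_fourier R f \<xi> * complex_of_real (h \<xi>))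
        = c * (LINT \<xi>|lebesgue. LINT x|lebesgue. ?e x \<xi> * fR x * complex_of_real (h \<xi>))"
      by (simp only: tf integral_mult_left_zero) (simp only: mult.assoc integral_mult_right_zero)
    also have "\<dots> = c * (LINT x|lebesgue. LINT \<xi>|lebesgue. ?e x \<xi> * fR x * complex_of_real (h \<xi>))"
      by (subst lebesgue_pair.Fubini_integral[OF pair]) simp
    also have "(\<lambda>x. LINT \<xi>|lebesgue. ?e x \<xi> * fR x * complex_of_real (h \<xi>)) = (\<lambda>x. f x * \<phi> x)"
    proof
      fix x
      have "(LINT \<xi>|lebesgue. ?e x \<xi> * fR x * complex_of_real (h \<xi>))
          = fR x * (LINT \<xi>|lebesgue. ?e x \<xi> * complex_of_real (h \<xi>))"
        by (simp add: mult_ac flip: integral_mult_right_zero)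
      also have "(LINT \<xi>|lebesgue. ?e x \<xi> * complex_of_real (h \<xi>)) = \<phi> x"
        by (rule \<phi>l)
      \<comment> \<open>Outside the ball norm x > R \<ge> A, so \<open>\<phi>\<close> vanishes and
        the cut-off values of \<open>f\<close> do not matter.\<close>
      finally show "(LINT \<xi>|lebesgue. ?e x \<xi> * fR x * complex_of_real (h \<xi>)) = f x * \<phi> x"
        using supp[of x] R by (auto simp: fR_def indicator_def)
    qed
    finally have TFJ: "(LINT \<xi>|lebesgue. truncated_fourier R f \<xi> * complex_of_real (h \<xi>)) = J"
      by (simp add: J_def)
    have "ennreal (norm (J - I)) = ennreal (norm (LINT \<xi>|lebesgue. (truncated_fourier R f \<xi> - F \<xi>) * complex_of_real (h \<xi>)))"
      unfolding TFJ[symmetric] I_def using TFh Fh by (simp add: left_diff_distrib)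
    also have "\<dots> \<le> (\<integral>\<^sup>+ \<xi>. ennreal (norm (truncated_fourier R f \<xi> - F \<xi>)) * ennreal (h \<xi>) \<partial>lebesgue)"
      using integral_norm_bound_ennreal[OF Bochner_Integration.integrable_diff[OF TFh Fh]] h(2)
      by (simp add: left_diff_distrib[symmetric] norm_mult ennreal_mult')
    finally have "(ennreal (norm (J - I)))\<^sup>2
        \<le> (\<integral>\<^sup>+ \<xi>. ennreal (norm (truncated_fourier R f \<xi> - F \<xi>)) * ennreal (h \<xi>) \<partial>lebesgue)\<^sup>2"
      by (intro power_mono) auto
    also have "\<dots> \<le> (\<integral>\<^sup>+ \<xi>. (ennreal (norm (truncated_fourier R f \<xi> - F \<xi>)))\<^sup>2 \<partial>lebesgue) *
        (\<integral>\<^sup>+ \<xi>. (ennreal (h \<xi>))\<^sup>2 \<partial>lebesgue)"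
      by (rule Cauchy_Schwarz_nn_integral) measurable
    finally show ?thesis
      by (simp add: ennreal_power h(2) H_def)
  qed
  \<comment> \<open>Finiteness of \<open>H\<close> excludes the indeterminate product of 0 and
    infinity.\<close>
  have "((\<lambda>R. (\<integral>\<^sup>+ \<xi>. ennreal ((norm (truncated_fourier R f \<xi> - F \<xi>))\<^sup>2) \<partial>lebesgue) * H) \<longlongrightarrow> 0 * H) at_top"
    using Hfin lim by (intro tendsto_mult_ennreal) auto
  then have "ennreal ((norm (J - I))\<^sup>2) \<le> 0 * H"
    by (rule tendsto_lowerbound) (use bound in \<open>auto intro: eventually_mono[OF eventually_ge_at_top[of A]]\<close>)
  then have "J = I" by simp
  then show "(LINT \<xi>|lebesgue. F \<xi> * complex_of_real (h \<xi>))
      = complex_of_real ((2 * pi) powr (- real DIM('a) / 2)) * (LINT x|lebesgue. f x * \<phi> x)"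
    by (simp add: I_def J_def c_def)
qed

section \<open>Test functions\<close>

lemma prod_Basis_Pair:
  fixes f :: "real \<times> 'a::euclidean_space \<Rightarrow> 'c::comm_monoid_mult"
  shows "(\<Prod>b\<in>Basis. f b) = f (1, 0) * (\<Prod>b\<in>Basis. f (0, b))"
proof -
  have "(\<Prod>b\<in>Basis. f b) = (\<Prod>b\<in>{(1::real, 0::'a)}. f b) * (\<Prod>b\<in>Pair 0 ` Basis. f b)"
    unfolding Basis_prod_def by (subst prod.union_disjoint[symmetric]) (auto simp: Basis_real_def)
  also have "(\<Prod>b\<in>Pair 0 ` Basis. f b) = (\<Prod>b\<in>Basis. f (0, b))"
    by (subst prod.reindex) (auto simp: inj_on_def)
  finally show ?thesis by simp
qed

text \<open>\<open>m\<close> is a multi-index. When \<open>H b k\<close> is the k-th derivative of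
  the factor in direction b, a partial derivative raises one entry of \<open>m\<close>, and
  smoothness of every order is one induction over all \<open>m\<close>.\<close>

definition tensor :: "('a::euclidean_space \<Rightarrow> nat \<Rightarrow> real \<Rightarrow> real) \<Rightarrow> ('a \<Rightarrow> nat) \<Rightarrow> 'a \<Rightarrow> real" where
  "tensor H m z = (\<Prod>b\<in>Basis. H b (m b) (z \<bullet> b))"

context
  fixes H :: "'a::euclidean_space \<Rightarrow> nat \<Rightarrow> real \<Rightarrow> real"
  assumes H: "\<And>b k x. (H b k has_field_derivative H b (Suc k) x) (at x)"
begin

lemma tensor_has_derivative:
  "((\<lambda>z. complex_of_real (tensor H m z)) has_derivative
     (\<lambda>v. complex_of_real (\<Sum>b\<in>Basis. (v \<bullet> b) * tensor H (m(b := Suc (m b))) z))) (at z)"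
proof -
  have "((\<lambda>z. H b (m b) (z \<bullet> b)) has_derivative (\<lambda>v. H b (Suc (m b)) (z \<bullet> b) * (v \<bullet> b))) (at z)" for b
    by (rule has_derivative_compose[OF bounded_linear.has_derivative[OF bounded_linear_inner_left has_derivative_ident]
          H[unfolded has_field_derivative_def]])
  then have "(tensor H m has_derivative
      (\<lambda>v. \<Sum>b\<in>Basis. H b (Suc (m b)) (z \<bullet> b) * (v \<bullet> b) * (\<Prod>j\<in>Basis - {b}. H j (m j) (z \<bullet> j)))) (at z)"
    unfolding tensor_def[abs_def] by (intro has_derivative_prod)
  moreover have "H b (Suc (m b)) (z \<bullet> b) * (v \<bullet> b) * (\<Prod>j\<in>Basis - {b}. H j (m j) (z \<bullet> j))
      = (v \<bullet> b) * tensor H (m(b := Suc (m b))) z" if "b \<in> Basis" for v b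
    unfolding tensor_def by (subst prod.remove[OF finite_Basis that]) (auto intro!: prod.cong)
  ultimately have "(tensor H m has_derivative
      (\<lambda>v. \<Sum>b\<in>Basis. (v \<bullet> b) * tensor H (m(b := Suc (m b))) z)) (at z)"
    by (simp cong: sum.cong)
  then show ?thesis by (rule has_derivative_of_real)
qed

lemma dir_deriv_tensor:
  assumes "b \<in> Basis"
  shows "dir_deriv b (\<lambda>z. complex_of_real (tensor H m z))
    = (\<lambda>z. complex_of_real (tensor H (m(b := Suc (m b))) z))"
proof
  fix z
  have "frechet_derivative (\<lambda>z. complex_of_real (tensor H m z)) (at z)
      = (\<lambda>v. complex_of_real (\<Sum>b\<in>Basis. (v \<bullet> b) * tensor H (m(b := Suc (m b))) z))"
    by (rule frechet_derivative_at[OF tensor_has_derivative, symmetric])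
  moreover have "(\<Sum>b'\<in>Basis. (b \<bullet> b') * tensor H (m(b' := Suc (m b'))) z)
      = (\<Sum>b'\<in>Basis. if b' = b then tensor H (m(b := Suc (m b))) z else 0)"
    using assms by (intro sum.cong) (auto simp: inner_Basis)
  ultimately show "dir_deriv b (\<lambda>z. complex_of_real (tensor H m z)) z = complex_of_real (tensor H (m(b := Suc (m b))) z)"
    using assms by (simp add: dir_deriv_def del: of_real_sum of_real_mult)
qed

lemma tensor_continuous: "continuous_on UNIV (\<lambda>z. complex_of_real (tensor H m z))"
  using tensor_has_derivative by (meson continuous_at_imp_continuous_on has_derivative_continuous)

lemma C_k_tensor: "C_k k (\<lambda>z. complex_of_real (tensor H m z))"
proof (induction k arbitrary: m)
  case 0
  show ?case using tensor_continuous by (simp only: C_k.simps)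
next
  case (Suc k)
  then show ?case
    using tensor_has_derivative by (auto simp: dir_deriv_tensor differentiable_def)
qed

end

text \<open>Since \<open>cutoff\<close> is even, the time derivative vanishes at \<open>t = 0\<close>, so that only \<open>u0 + u1\<close>
  enters the data term.\<close>

definition test_fn :: "real \<Rightarrow> real \<times> 'a::euclidean_space \<Rightarrow> real" where
  "test_fn R z = cutoff (fst z / R\<^sup>2) * cutoff_nd R (snd z)"

text \<open>The formal adjoint of the damped wave operator, hence the minus sign of the first-order
  term.\<close>

definition damped_wave_op :: "(real \<times> 'a::euclidean_space \<Rightarrow> complex) \<Rightarrow> real \<times> 'a \<Rightarrow> complex" where
  "damped_wave_op \<psi> z = time_deriv (time_deriv \<psi>) z - time_deriv \<psi> z - laplacian \<psi> z"

lemma test_fn_nonneg: "0 \<le> test_fn R z"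
  by (simp add: test_fn_def cutoff_nd_def cutoff_nonneg prod_nonneg)

lemma test_fn_eq_0:
  fixes z :: "real \<times> 'a::euclidean_space"
  assumes R: "0 < R" and z: "z \<notin> cbox (- (R\<^sup>2), - (R *\<^sub>R One)) (R\<^sup>2, R *\<^sub>R One)"
  shows "test_fn R z = 0"
proof -
  obtain t x where tx: "z = (t, x)" by (cases z)
  have "R\<^sup>2 < \<bar>t\<bar> \<or> (\<exists>b\<in>Basis. R < \<bar>x \<bullet> b\<bar>)"
    using z by (force simp: tx cbox_Pair_eq mem_box)
  then have "1 \<le> \<bar>t / R\<^sup>2\<bar> \<or> (\<exists>b\<in>Basis. 1 \<le> \<bar>x \<bullet> b / R\<bar>)"
    using R by (auto simp: field_simps abs_divide intro: less_imp_le)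
  then have "cutoff (t / R\<^sup>2) = 0 \<or> (\<exists>b\<in>Basis. cutoff (x \<bullet> b / R) = 0)"
    using cutoff_eq_0 by blast
  then show ?thesis
    by (auto simp: test_fn_def tx cutoff_nd_def)
qed

section \<open>Parabolic scaling and the adjoint operator on the test functions\<close>

context
  fixes G :: "nat \<Rightarrow> real \<Rightarrow> real" and R :: real
  assumes G0: "G 0 = cutoff"
    and G: "\<And>k x. (G k has_field_derivative G (Suc k) x) (at x)"
    and R: "0 < R"
begin

text \<open>The basis vector (1, 0) is the time direction, where the length scale is
  \<open>R\<^sup>2\<close>; in space it is R. The division is the chain-rule factor of the k-th
  derivative.\<close>

definition scaled :: "real \<times> 'a::euclidean_space \<Rightarrow> nat \<Rightarrow> real \<Rightarrow> real" where
  "scaled b k t = (let \<rho> = if b = (1, 0) then R\<^sup>2 else R in G k (t / \<rho>) / \<rho> ^ k)"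

lemma scaled_deriv: "(scaled b k has_field_derivative scaled b (Suc k) x) (at x)"
proof -
  have *: "((\<lambda>t. G k (t / \<rho>) / \<rho> ^ k) has_field_derivative G (Suc k) (x / \<rho>) / \<rho> ^ Suc k) (at x)"
    if "\<rho> > 0" for \<rho>
    using that by (auto intro!: derivative_eq_intros DERIV_chain2[OF G])
  show ?thesis
    unfolding scaled_def[abs_def] Let_def using R by (intro *) auto
qed

lemma test_fn_eq_tensor: "test_fn R = tensor (scaled :: real \<times> 'a::euclidean_space \<Rightarrow> _) (\<lambda>_. 0)"
  by (auto simp: fun_eq_iff tensor_def prod_Basis_Pair scaled_def G0 test_fn_def cutoff_nd_def)

lemma Basis_Pair: "(1, 0) \<in> (Basis :: (real \<times> 'a::euclidean_space) set)"
  "b \<in> Basis \<Longrightarrow> (0, b) \<in> (Basis :: (real \<times> 'a) set)"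
  by (auto simp: Basis_prod_def)

lemma damped_wave_op_test_fn:
  fixes z :: "real \<times> 'a::euclidean_space"
  shows "damped_wave_op (\<lambda>z. complex_of_real (test_fn R z)) z = complex_of_real (
    tensor scaled ((\<lambda>_. 0)((1, 0) := 2)) z - tensor scaled ((\<lambda>_. 0)((1, 0) := 1)) z
    - (\<Sum>b\<in>Basis. tensor scaled ((\<lambda>_. 0)((0, b) := 2)) z))"
  unfolding damped_wave_op_def laplacian_def time_deriv_def test_fn_eq_tensor
  by (simp add: dir_deriv_tensor[of "scaled :: real \<times> 'a \<Rightarrow> _", OF scaled_deriv] Basis_Pair numeral_2_eq_2 cong: sum.cong)


text \<open>Each of the n + 1 factors contributes one \<open>K\<close> and the power q of its
  cutoff. The differentiated factor also gains the j-th inverse power of its length scale, which the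
  last hypothesis makes at most \<open>1 / R\<^sup>2\<close>.\<close>

lemma tensor_single_bound:
  fixes z :: "real \<times> 'a::euclidean_space"
  assumes K: "0 \<le> K" "\<And>k x. k \<le> 2 \<Longrightarrow> \<bar>G k x\<bar> \<le> K * cutoff x powr q"
    and b0: "b0 \<in> Basis" and j: "j \<le> 2" and wt: "R\<^sup>2 \<le> (if b0 = (1, 0) then R\<^sup>2 else R) ^ j"
  shows "\<bar>tensor scaled ((\<lambda>_. 0)(b0 := j)) z\<bar> \<le> K ^ Suc DIM('a) / R\<^sup>2 * test_fn R z powr q"
proof -
  define \<rho> where "\<rho> = (\<lambda>b::real \<times> 'a. if b = (1, 0) then R\<^sup>2 else R)"
  have scaled_eq: "scaled b k t = G k (t / \<rho> b) / \<rho> b ^ k" for b k t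
    by (simp add: scaled_def Let_def \<rho>_def)
  have "\<bar>tensor scaled ((\<lambda>_. 0)(b0 := j)) z\<bar> = (\<Prod>b\<in>Basis. \<bar>scaled b (((\<lambda>_. 0)(b0 := j)) b) (z \<bullet> b)\<bar>)"
    by (simp only: tensor_def abs_prod)
  also have "\<dots> \<le> (\<Prod>b\<in>Basis. (K * cutoff (z \<bullet> b / \<rho> b) powr q) * (if b = b0 then 1 / R\<^sup>2 else 1))"
  proof (rule prod_mono, intro conjI)
    fix b :: "real \<times> 'a" assume "b \<in> Basis"
    have \<rho>0: "0 < \<rho> b" using R by (simp add: \<rho>_def)
    show "\<bar>scaled b (((\<lambda>_. 0)(b0 := j)) b) (z \<bullet> b)\<bar>
        \<le> (K * cutoff (z \<bullet> b / \<rho> b) powr q) * (if b = b0 then 1 / R\<^sup>2 else 1)"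
    proof (cases "b = b0")
      case True
      have "\<bar>G j (z \<bullet> b / \<rho> b)\<bar> * (1 / \<rho> b ^ j) \<le> (K * cutoff (z \<bullet> b / \<rho> b) powr q) * (1 / R\<^sup>2)"
        using K j \<rho>0 R wt True by (intro mult_mono K frac_le) (auto simp: \<rho>_def)
      then show ?thesis
        using True \<rho>0 by (simp add: scaled_eq abs_divide power_abs)
    next
      case False
      then show ?thesis
        using K(2)[of 0 "z \<bullet> b / \<rho> b"] by (simp add: scaled_eq)
    qed
  qed simp
  also have "\<dots> = K ^ Suc DIM('a) / R\<^sup>2 * (\<Prod>b\<in>Basis. cutoff (z \<bullet> b / \<rho> b) powr q)"
    using b0 by (simp add: prod.distrib prod.delta)
  also have "(\<Prod>b\<in>Basis. cutoff (z \<bullet> b / \<rho> b) powr q) = test_fn R z powr q"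
    unfolding test_fn_eq_tensor tensor_def
    by (subst prod_powr_distrib[symmetric])
      (simp add: scaled_eq G0)
  finally show ?thesis .
qed

lemma damped_wave_op_bound:
  fixes z :: "real \<times> 'a::euclidean_space"
  assumes K: "0 \<le> K" "\<And>k x. k \<le> 2 \<Longrightarrow> \<bar>G k x\<bar> \<le> K * cutoff x powr q" and R1: "1 \<le> R"
  shows "norm (damped_wave_op (\<lambda>z. complex_of_real (test_fn R z)) z)
    \<le> (2 + real DIM('a)) * K ^ Suc DIM('a) / R\<^sup>2 * test_fn R z powr q"
proof -
  let ?A = "K ^ Suc DIM('a) / R\<^sup>2 * test_fn R z powr q"
  let ?T = "\<lambda>b j. tensor scaled ((\<lambda>_. 0)(b := j)) z"
  \<comment> \<open>The second time derivative decays like the fourth inverse power of R; for R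
    \<ge> 1 this is no larger than the \<open>1 / R\<^sup>2\<close> of the first time and second
    space derivatives.\<close>
  have "R\<^sup>2 * 1 \<le> R\<^sup>2 * R\<^sup>2" using R1 by (intro mult_left_mono) auto
  then have R4: "R\<^sup>2 \<le> (R\<^sup>2)\<^sup>2" by (simp add: power2_eq_square)
  have 1: "\<bar>?T (1, 0) 2\<bar> \<le> ?A" "\<bar>?T (1, 0) 1\<bar> \<le> ?A"
    using R4 by (intro tensor_single_bound[OF K] Basis_Pair; simp)+
  have "\<bar>?T (0, b) 2\<bar> \<le> ?A" if "b \<in> Basis" for b :: 'a
    using that by (intro tensor_single_bound[OF K] Basis_Pair) auto
  then have "\<bar>\<Sum>b\<in>Basis. ?T (0, b) 2\<bar> \<le> (\<Sum>b\<in>(Basis::'a set). ?A)"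
    by (intro order_trans[OF sum_abs] sum_mono)
  then have 2: "\<bar>\<Sum>b\<in>Basis. ?T (0, b) 2\<bar> \<le> real DIM('a) * ?A"
    by simp
  have "norm (damped_wave_op (\<lambda>z. complex_of_real (test_fn R z)) z)
      = \<bar>?T (1, 0) 2 - ?T (1, 0) 1 - (\<Sum>b\<in>Basis. ?T (0, b) 2)\<bar>"
    unfolding damped_wave_op_test_fn norm_of_real ..
  also have "\<dots> \<le> ?A + ?A + real DIM('a) * ?A"
    using 1 2 by linarith
  also have "\<dots> = (2 + real DIM('a)) * ?A"
    by (simp only: distrib_right)
  finally show ?thesis by (simp add: mult.assoc)
qed

lemma damped_wave_op_continuous:
  "continuous_on UNIV (damped_wave_op (\<lambda>z::real \<times> 'a::euclidean_space. complex_of_real (test_fn R z)))"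
proof -
  note c = tensor_continuous[of "scaled :: real \<times> 'a \<Rightarrow> _", OF scaled_deriv]
  show ?thesis
    unfolding damped_wave_op_test_fn[abs_def] of_real_diff of_real_sum
    by (intro continuous_on_diff continuous_on_sum c)
qed

lemma time_deriv_test_fn_0:
  "time_deriv (\<lambda>z::real \<times> 'a::euclidean_space. complex_of_real (test_fn R z)) (0, x) = 0"
proof -
  have "((\<lambda>x. cutoff (- x)) has_field_derivative - G 1 0) (at 0)"
    using DERIV_chain2[OF G[of 0 "- 0"] DERIV_minus[OF DERIV_ident]] by (simp add: G0)
  then have "(cutoff has_field_derivative - G 1 0) (at 0)"
    by (simp add: cutoff_even)
  moreover have "(cutoff has_field_derivative G 1 0) (at 0)"
    using G[of 0 0] by (simp add: G0)
  ultimately have "- G 1 0 = G 1 0"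
    by (rule DERIV_unique)
  then have "G 1 0 = 0" by simp
  then have "scaled (1::real, 0::'a) 1 0 = 0"
    by (simp add: scaled_def)
  then have "tensor scaled ((\<lambda>_. 0)((1, 0) := 1)) (0, x) = 0"
    unfolding tensor_def by (subst prod_Basis_Pair) simp
  then show ?thesis
    unfolding time_deriv_def test_fn_eq_tensor
    by (simp add: dir_deriv_tensor[of "scaled :: real \<times> 'a \<Rightarrow> _", OF scaled_deriv] Basis_Pair)
qed

lemma C_k_test_fn: "C_k k (\<lambda>z::real \<times> 'a::euclidean_space. complex_of_real (test_fn R z))"
  unfolding test_fn_eq_tensor by (rule C_k_tensor[of "scaled :: real \<times> 'a \<Rightarrow> _", OF scaled_deriv])

end

text \<open>The time support ends at or before \<open>R\<^sup>2\<close>, so the strict bound by T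
  also covers the closure.\<close>

lemma test_function_test_fn:
  assumes R: "0 < R" and T: "ereal (R\<^sup>2) < T"
  shows "test_function T (\<lambda>z::real \<times> 'a::euclidean_space. complex_of_real (test_fn R z))"
proof (rule cutoff_derivatives)
  fix G assume G: "G 0 = cutoff" "\<And>k x. (G k has_field_derivative G (Suc k) x) (at x)"
  let ?Z = "{z::real \<times> 'a. complex_of_real (test_fn R z) \<noteq> 0}"
  let ?K = "cbox (- (R\<^sup>2), - (R *\<^sub>R One)) (R\<^sup>2, R *\<^sub>R One) :: (real \<times> 'a) set"
  have sub: "closure ?Z \<subseteq> ?K"
  proof (rule closure_minimal)
    show "?Z \<subseteq> ?K"
    proof
      fix z assume "z \<in> ?Z"
      then have "test_fn R z \<noteq> 0" by simp
      then show "z \<in> ?K" using test_fn_eq_0[OF R, of z] by metis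
    qed
  qed (rule closed_cbox)
  then have "compact (closure ?Z)"
    by (meson bounded_cbox bounded_subset closed_closure compact_eq_bounded_closed)
  moreover have "ereal (fst z) < T" if "z \<in> closure ?Z" for z
  proof -
    have "z \<in> ?K" using sub that by blast
    then have "fst z \<le> R\<^sup>2" by (cases z) (simp add: cbox_Pair_eq)
    then show ?thesis using T by (meson ereal_less_eq(3) le_less_trans)
  qed
  ultimately show ?thesis
    using C_k_test_fn[OF G R] by (auto simp: test_function_def)
qed

section \<open>Comparison of test functions across scales\<close>

lemma test_fn_continuous: "0 < R \<Longrightarrow> continuous_on UNIV (test_fn R :: real \<times> 'a::euclidean_space \<Rightarrow> real)"
  unfolding test_fn_def[abs_def] cutoff_nd_def
  by (intro continuous_intros continuous_on_compose2[OF continuous_cutoff]) auto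

text \<open>For t in the support and R large, t/R is so near 0 that \<open>cutoff (t / R)\<close>
  exceeds half of \<open>cutoff 0\<close>. The constant scales the bound \<open>M\<close> of
  \<open>cutoff\<close> down to that half.\<close>

lemma cutoff_scaled_ge:
  obtains c R0 where "0 < c" "1 \<le> R0" "\<And>R t. R0 \<le> R \<Longrightarrow> c * cutoff t \<le> cutoff (t / R)"
proof -
  obtain M where M: "\<And>x. \<bar>cutoff x\<bar> \<le> M" using cutoff_bounded by blast
  have M0: "0 < M" using M[of 0] cutoff_0_pos by simp
  have "(cutoff \<longlongrightarrow> cutoff 0) (nhds 0)"
    using continuous_cutoff
    by (simp add: continuous_on_eq_continuous_at isCont_def tendsto_at_iff_tendsto_nhds)
  then have "\<forall>\<^sub>F t in nhds 0. cutoff 0 / 2 < cutoff t"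
    using cutoff_0_pos by (intro order_tendstoD) auto
  then obtain d where d: "0 < d" "\<And>t. \<bar>t\<bar> < d \<Longrightarrow> cutoff 0 / 2 < cutoff t"
    by (auto simp: eventually_nhds_metric dist_real_def)
  have "cutoff 0 / (2 * M) * cutoff t \<le> cutoff (t / R)" if R: "max 1 (2 / d) \<le> R" for R t
  proof (cases "\<bar>t\<bar> < 1")
    case True
    have "\<bar>t\<bar> < R * d"
    proof -
      have "2 \<le> R * d" using R d(1) by (simp add: field_simps)
      then show ?thesis using True by simp
    qed
    then have "\<bar>t / R\<bar> < d" using R by (simp add: abs_divide field_simps)
    then have "cutoff 0 / 2 < cutoff (t / R)" by (rule d(2))
    moreover have "cutoff 0 / (2 * M) * cutoff t \<le> cutoff 0 / (2 * M) * M"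
      using M[of t] M0 cutoff_0_pos by (intro mult_left_mono) auto
    ultimately show ?thesis using M0 by simp
  qed (simp add: cutoff_eq_0 cutoff_nonneg)
  then show thesis
    using M0 cutoff_0_pos by (intro that[of "cutoff 0 / (2 * M)" "max 1 (2 / d)"]) auto
qed

lemma test_fn_ge:
  obtains c R0 where "0 < c" "1 \<le> R0"
    "\<And>R (z :: real \<times> 'a::euclidean_space). R0 \<le> R \<Longrightarrow> c * test_fn 1 z \<le> test_fn R z"
proof (rule cutoff_scaled_ge)
  fix c R0 :: real
  assume c: "0 < c" "1 \<le> R0" "\<And>R t. R0 \<le> R \<Longrightarrow> c * cutoff t \<le> cutoff (t / R)"
  have "c ^ Suc DIM('a) * test_fn 1 z \<le> test_fn R z" if R: "R0 \<le> R" for R and z :: "real \<times> 'a"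
  proof -
    \<comment> \<open>The time variable is scaled by \<open>R\<^sup>2\<close>, so the
      one-dimensional comparison must also hold at that scale.\<close>
    have "R * 1 \<le> R * R" using R c(2) by (intro mult_left_mono) auto
    then have R2: "R0 \<le> R\<^sup>2" using R by (simp add: power2_eq_square)
    have "c ^ Suc DIM('a) * test_fn 1 z = (c * cutoff (fst z)) * (\<Prod>b\<in>Basis. c * cutoff (snd z \<bullet> b))"
      by (simp add: test_fn_def cutoff_nd_def prod.distrib)
    also have "\<dots> \<le> cutoff (fst z / R\<^sup>2) * (\<Prod>b\<in>Basis. cutoff (snd z \<bullet> b / R))"
    proof (rule mult_mono)
      show "c * cutoff (fst z) \<le> cutoff (fst z / R\<^sup>2)" by (rule c(3)[OF R2])
      have "0 \<le> c * cutoff (snd z \<bullet> b) \<and> c * cutoff (snd z \<bullet> b) \<le> cutoff (snd z \<bullet> b / R)" for b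
        using c(1) c(3)[OF R] cutoff_nonneg by simp
      then show "(\<Prod>b\<in>Basis. c * cutoff (snd z \<bullet> b)) \<le> (\<Prod>b\<in>Basis. cutoff (snd z \<bullet> b / R))"
        "0 \<le> (\<Prod>b\<in>Basis. c * cutoff (snd z \<bullet> b))"
        by (blast intro: prod_mono prod_nonneg)+
    qed (rule cutoff_nonneg)
    finally show ?thesis by (simp add: test_fn_def cutoff_nd_def)
  qed
  then show thesis
    by (rule that[of "c ^ Suc DIM('a)" R0, rotated -1]) (use c(1,2) in \<open>simp_all only: zero_less_power\<close>)
qed

lemma damped_wave_op_test_fn_bound:
  assumes "0 < q" "q < 1"
  obtains B where "0 < B" "\<And>R (z :: real \<times> 'a::euclidean_space). 1 \<le> R \<Longrightarrow>
    norm (damped_wave_op (\<lambda>z. complex_of_real (test_fn R z)) z) \<le> B / R\<^sup>2 * test_fn R z powr q"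
proof (rule cutoff_derivatives)
  fix G assume G: "G 0 = cutoff" "\<And>k x. (G k has_field_derivative G (Suc k) x) (at x)"
    "\<And>k q. 0 < q \<Longrightarrow> q < 1 \<Longrightarrow> \<exists>K\<ge>0. \<forall>x. \<bar>G k x\<bar> \<le> K * cutoff x powr q"
  obtain K where K: "\<And>k. 0 \<le> K k" "\<And>k x. \<bar>G k x\<bar> \<le> K k * cutoff x powr q"
    using G(3)[OF assms] by metis
  \<comment> \<open>The operator involves derivatives of order at most two, so one constant serves
    all of them.\<close>
  define M where "M = Max (K ` {..2})"
  have M: "0 \<le> M" "K k \<le> M" if "k \<le> 2" for k
    unfolding M_def using that K(1)[of k] by (auto intro: Max_ge order_trans[OF _ Max_ge])
  have M': "\<bar>G k x\<bar> \<le> M * cutoff x powr q" if "k \<le> 2" for k x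
    using K(2)[of k x] mult_right_mono[OF M(2)[OF that], of "cutoff x powr q"] by simp
  have M0: "0 \<le> M" using M(1)[of 0] by simp
  let ?B = "(2 + real DIM('a)) * M ^ Suc DIM('a)"
  \<comment> \<open>Adding 1 keeps the constant strictly positive even when \<open>M\<close> is
    0.\<close>
  have "norm (damped_wave_op (\<lambda>z. complex_of_real (test_fn R z)) z) \<le> (?B + 1) / R\<^sup>2 * test_fn R z powr q"
    if R: "1 \<le> R" for R and z :: "real \<times> 'a"
  proof -
    have "norm (damped_wave_op (\<lambda>z. complex_of_real (test_fn R z)) z) \<le> ?B / R\<^sup>2 * test_fn R z powr q"
      using R by (intro damped_wave_op_bound[OF G(1,2) _ M0 M' R]) auto
    also have "\<dots> \<le> (?B + 1) / R\<^sup>2 * test_fn R z powr q"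
      by (intro mult_right_mono divide_right_mono) auto
    finally show ?thesis .
  qed
  moreover have "0 < ?B + 1" using M0 by (simp add: add_nonneg_pos)
  ultimately show thesis using that by blast
qed

lemma damped_wave_op_test_fn_continuous:
  assumes "0 < R"
  shows "continuous_on UNIV (damped_wave_op (\<lambda>z::real \<times> 'a::euclidean_space. complex_of_real (test_fn R z)))"
proof (rule cutoff_derivatives)
  fix G assume G: "G 0 = cutoff" "\<And>k x. (G k has_field_derivative G (Suc k) x) (at x)"
  show ?thesis by (rule damped_wave_op_continuous[OF G assms])
qed

lemma time_deriv_test_fn:
  assumes "0 < R"
  shows "time_deriv (\<lambda>z::real \<times> 'a::euclidean_space. complex_of_real (test_fn R z)) (0, x) = 0"
proof (rule cutoff_derivatives)
  fix G assume G: "G 0 = cutoff" "\<And>k x. (G k has_field_derivative G (Suc k) x) (at x)"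
  show ?thesis by (rule time_deriv_test_fn_0[OF G assms])
qed

section \<open>Mass estimates for weak solutions\<close>

lemma time_strip_sets: "time_strip T \<in> sets lebesgue"
proof -
  have "closed {z::real \<times> 'a::euclidean_space. 0 \<le> fst z}"
    by (intro closed_Collect_le continuous_intros)
  moreover have "open {z::real \<times> 'a. ereal (fst z) < T}"
    by (intro open_Collect_less continuous_intros continuous_on_ereal)
  ultimately have "{z::real \<times> 'a. 0 \<le> fst z} \<inter> {z. ereal (fst z) < T} \<in> sets borel"
    by (intro sets.Int) auto
  also have "{z::real \<times> 'a. 0 \<le> fst z} \<inter> {z. ereal (fst z) < T} = time_strip T"
    by (auto simp: time_strip_def)
  finally show ?thesis by auto
qed

definition mass :: "real \<Rightarrow> ereal \<Rightarrow> (real \<times> 'a::euclidean_space \<Rightarrow> complex) \<Rightarrow> real \<Rightarrow> real" where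
  "mass p T u R = (LINT z:time_strip T|lebesgue. norm (u z) powr p * test_fn R z)"

definition data_pairing :: "('a::euclidean_space \<Rightarrow> complex) \<Rightarrow> ('a \<Rightarrow> complex) \<Rightarrow> real \<Rightarrow> real" where
  "data_pairing u0 u1 R = Re (LINT x|lebesgue. (u0 x + u1 x) * complex_of_real (test_fn R (0, x)))"

context
  fixes T :: ereal and R :: real
  assumes R: "0 < R" and T: "ereal (R\<^sup>2) < T"
begin

abbreviation supp_box :: "(real \<times> 'a::euclidean_space) set" where
  "supp_box \<equiv> cbox (0, - (R *\<^sub>R One)) (R\<^sup>2, R *\<^sub>R One)"

lemma supp_box_subset: "supp_box \<subseteq> time_strip T"
proof
  fix z :: "real \<times> 'a" assume "z \<in> supp_box"
  then have "0 \<le> fst z" "fst z \<le> R\<^sup>2" by (cases z, simp add: cbox_Pair_eq)+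
  then show "z \<in> time_strip T"
    using T by (auto simp: time_strip_def intro: le_less_trans[of _ "ereal (R\<^sup>2)"])
qed

lemma test_fn_eq_0_strip: "z \<in> time_strip T \<Longrightarrow> z \<notin> supp_box \<Longrightarrow> test_fn R z = 0"
proof (rule test_fn_eq_0[OF R], rule notI)
  assume "z \<in> time_strip T" "z \<notin> supp_box" "z \<in> cbox (- (R\<^sup>2), - (R *\<^sub>R One)) (R\<^sup>2, R *\<^sub>R One)"
  then show False by (cases z) (simp add: cbox_Pair_eq time_strip_def)
qed

lemma measure_supp_box: "measure lebesgue (supp_box :: (real \<times> 'a::euclidean_space) set) = R\<^sup>2 * (2 * R) ^ DIM('a)"
proof -
  have "measure lborel (cbox (- (R *\<^sub>R One)) (R *\<^sub>R One) :: 'a set) = (2 * R) ^ DIM('a)"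
    using R by (subst content_cbox) (auto simp: inner_sum_left inner_Basis)
  moreover have "measure lborel (cbox 0 (R\<^sup>2)) = R\<^sup>2" by simp
  ultimately show ?thesis by (simp add: content_Pair)
qed

text \<open>Within the strip the test function lives on a compact box, where it is bounded and the
  p-th power of u is integrable by assumption.\<close>

lemma mass_integrable:
  assumes u: "Lp_loc p T u"
  shows "set_integrable lebesgue (time_strip T) (\<lambda>z::real \<times> 'a::euclidean_space. norm (u z) powr p * test_fn R z)"
proof -
  have int: "integrable lebesgue (\<lambda>z. indicator supp_box z *\<^sub>R norm (u z) powr p)"
    using u supp_box_subset compact_cbox unfolding Lp_loc_def set_integrable_def[symmetric] by blast
  have [measurable]: "(\<lambda>z. test_fn R z) \<in> borel_measurable (lebesgue :: (real \<times> 'a) measure)"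
    using borel_measurable_continuous_onI[OF test_fn_continuous[OF R]] by (intro measurable_completion) simp
  have "compact (test_fn R ` (supp_box :: (real \<times> 'a) set))"
    by (intro compact_continuous_image compact_cbox continuous_on_subset[OF test_fn_continuous[OF R]]) auto
  then obtain N where N: "\<And>z::real \<times> 'a. z \<in> supp_box \<Longrightarrow> \<bar>test_fn R z\<bar> \<le> N"
    using compact_imp_bounded by (force simp: bounded_iff simp del: cbox_Pair_eq)
  have eq: "indicator (time_strip T) z *\<^sub>R (norm (u z) powr p * test_fn R z)
      = (indicator supp_box z *\<^sub>R norm (u z) powr p) * test_fn R z" for z
    using test_fn_eq_0_strip[of z] supp_box_subset by (auto simp: indicator_def simp del: cbox_Pair_eq)
  show ?thesis
    unfolding set_integrable_def eq
  proof (rule Bochner_Integration.integrable_bound)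
    show "integrable lebesgue (\<lambda>z. N * (indicator supp_box z *\<^sub>R norm (u z) powr p))"
      using int by simp
    show "(\<lambda>z. (indicator supp_box z *\<^sub>R norm (u z) powr p) * test_fn R z) \<in> borel_measurable lebesgue"
      using int by (intro borel_measurable_times) auto
    have "\<bar>test_fn R z\<bar> * norm (u z) powr p \<le> \<bar>N\<bar> * norm (u z) powr p" if "z \<in> supp_box" for z
      using N[OF that] by (intro mult_right_mono) auto
    then show "AE z in lebesgue. norm ((indicator supp_box z *\<^sub>R norm (u z) powr p) * test_fn R z)
        \<le> norm (N * (indicator supp_box z *\<^sub>R norm (u z) powr p))"
      by (auto simp: indicator_def abs_mult mult.commute simp del: cbox_Pair_eq)
  qed
qed

lemma mass_nonneg: "0 \<le> mass p T u R"
  unfolding mass_def set_lebesgue_integral_def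
  by (intro integral_nonneg_AE) (auto simp: test_fn_nonneg indicator_def)

text \<open>The free parameter \<open>\<delta>\<close> of Young's inequality serves both bounds on the mass: \<open>\<delta> = 1/2\<close>
  absorbs the linear term and gives the upper bound, while a large \<open>\<delta>\<close> depending on \<open>\<epsilon>\<close> gives the
  lower bound.\<close>

lemma mass_inequality:
  fixes u :: "real \<times> 'a::euclidean_space \<Rightarrow> complex"
  assumes weak: "weak_solution p \<epsilon> u0 u1 T u"
    and p: "1 < p" "1 / p + 1 / p' = 1"
    and B: "0 < B" "\<And>z::real \<times> 'a. norm (damped_wave_op (\<lambda>z. complex_of_real (test_fn R z)) z)
      \<le> B / R\<^sup>2 * test_fn R z powr (1 / p)"
    and \<delta>: "0 < \<delta>"
  shows "mass p T u R + \<epsilon> * data_pairing u0 u1 R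
    \<le> \<delta> * mass p T u R + \<delta> powr (1 - p') * (B / R\<^sup>2) powr p' * (R\<^sup>2 * (2 * R) ^ DIM('a))"
proof -
  let ?S = "time_strip T :: (real \<times> 'a) set"
  let ?\<psi> = "\<lambda>z::real \<times> 'a. complex_of_real (test_fn R z)"
  let ?c = "\<delta> powr (1 - p') * (B / R\<^sup>2) powr p'"
  have p'1: "1 < p'"
  proof -
    have "1 / p < 1" "0 < 1 / p" using p(1) by auto
    then have "0 < 1 / p'" "1 / p' < 1" using p(2) by linarith+
    then show ?thesis by (auto simp: field_simps zero_less_divide_iff)
  qed
  have p'p: "p' / p = p' - 1"
    using p p'1 by (simp add: field_simps)
  have Lp: "Lp_loc p T u" using weak by (simp add: weak_solution_def)
  have int: "integrable lebesgue (\<lambda>z. indicator ?S z *\<^sub>R (norm (u z) powr p * test_fn R z))"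
    using mass_integrable[OF Lp] by (simp add: set_integrable_def)
  have eq: "(LINT z:?S|lebesgue. complex_of_real (norm (u z) powr p) * ?\<psi> z)
      + complex_of_real \<epsilon> * (LINT x|lebesgue. (u0 x + u1 x) * ?\<psi> (0, x))
      = (LINT z:?S|lebesgue. u z * damped_wave_op ?\<psi> z)"
  proof -
    have "\<forall>\<psi>. test_function T \<psi> \<longrightarrow>
        (LINT z:?S|lebesgue. complex_of_real (norm (u z) powr p) * \<psi> z)
        + complex_of_real \<epsilon> * (LINT x|lebesgue. (u0 x + u1 x) * \<psi> (0, x))
        - complex_of_real \<epsilon> * (LINT x|lebesgue. u0 x * time_deriv \<psi> (0, x))
        = (LINT z:?S|lebesgue. u z * damped_wave_op \<psi> z)"
      using weak unfolding weak_solution_def damped_wave_op_def by (rule conjunct2)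
    from this[rule_format, OF test_function_test_fn[OF R T]] show ?thesis
      by (simp add: time_deriv_test_fn[OF R])
  qed
  have 1: "(LINT z:?S|lebesgue. complex_of_real (norm (u z) powr p) * ?\<psi> z) = complex_of_real (mass p T u R)"
    unfolding mass_def set_lebesgue_integral_def
    by (simp add: scaleR_conv_of_real flip: integral_complex_of_real)
  let ?w = "\<lambda>z. indicator ?S z *\<^sub>R (u z * damped_wave_op ?\<psi> z)"
  let ?g = "\<lambda>z. \<delta> * (indicator ?S z *\<^sub>R (norm (u z) powr p * test_fn R z)) + ?c * indicator supp_box z"
  have box_finite: "emeasure lebesgue (supp_box :: (real \<times> 'a) set) < \<infinity>"
    using emeasure_bounded_finite[OF bounded_cbox] by (simp del: cbox_Pair_eq)
  have gint: "integrable lebesgue ?g"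
    using int by (intro Bochner_Integration.integrable_add integrable_mult_right integrable_real_indicator)
      (use box_finite in \<open>auto simp del: cbox_Pair_eq\<close>)
  have wmeas: "?w \<in> borel_measurable lebesgue"
  proof -
    have "(\<lambda>z. indicator ?S z *\<^sub>R u z) \<in> borel_measurable lebesgue"
      using Lp time_strip_sets[of T] by (subst borel_measurable_restrict_space_iff[symmetric]) (auto simp: Lp_loc_def)
    moreover have "damped_wave_op ?\<psi> \<in> borel_measurable lebesgue"
      using borel_measurable_continuous_onI[OF damped_wave_op_test_fn_continuous[OF R]]
      by (intro measurable_completion) simp
    ultimately have "(\<lambda>z. (indicator ?S z *\<^sub>R u z) * damped_wave_op ?\<psi> z) \<in> borel_measurable lebesgue"
      by (rule borel_measurable_times)
    then show ?thesis by simp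
  qed
  have c0: "0 \<le> ?c" by simp
  have wg: "norm (?w z) \<le> ?g z" for z
  proof (cases "z \<in> ?S")
    case True
    have "norm (u z) * norm (damped_wave_op ?\<psi> z) \<le> \<delta> * (norm (u z) powr p * test_fn R z) + ?c * indicator supp_box z"
    proof (cases "z \<in> supp_box")
      case False
      then have "test_fn R z = 0" using test_fn_eq_0_strip[OF True] by blast
      \<comment> \<open>\<open>0 powr (1 / p)\<close> is 0, so the bound \<open>B\<close> makes the
        operator vanish wherever the test function does.\<close>
      then have "norm (damped_wave_op ?\<psi> z) = 0" using B(2)[of z] by simp
      then show ?thesis using False \<open>test_fn R z = 0\<close> by (simp del: cbox_Pair_eq)
    next
      case in_box: True
      \<comment> \<open>The powers of \<open>\<delta>\<close> cancel in the product of
        \<open>a\<close> and \<open>b\<close>. After Young they become \<open>\<delta>\<close> on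
        the mass and \<open>\<delta> powr (1 - p')\<close> on the error, since p'/p = p' -
        1.\<close>
      define a where "a = \<delta> powr (1 / p) * norm (u z) * test_fn R z powr (1 / p)"
      define b where "b = \<delta> powr (- 1 / p) * (B / R\<^sup>2)"
      have ab: "a \<ge> 0" "b \<ge> 0" using B(1) R by (auto simp: a_def b_def)
      have "norm (u z) * norm (damped_wave_op ?\<psi> z) \<le> norm (u z) * (B / R\<^sup>2 * test_fn R z powr (1 / p))"
        by (intro mult_left_mono B(2)) auto
      also have "\<dots> = a * b"
        using \<delta> by (simp add: a_def b_def powr_minus field_simps)
      also have "\<dots> \<le> a powr p / p + b powr p' / p'"
        using Youngs_inequality[OF p(1) p'1 p(2) ab] .
      also have "\<dots> \<le> a powr p + b powr p'"
      proof -
        have "x / q \<le> x" if "0 \<le> x" "1 < q" for x q :: real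
          using that mult_left_mono[of 1 q x] by (simp add: divide_le_eq)
        then show ?thesis using p(1) p'1 by (intro add_mono) auto
      qed
      also have "a powr p = \<delta> * (norm (u z) powr p * test_fn R z)"
        using \<delta> p(1) by (simp add: a_def powr_mult powr_powr test_fn_nonneg)
      also have "b powr p' = ?c"
      proof -
        have "- 1 / p * p' = 1 - p'" using p'p by simp
        then show ?thesis unfolding b_def powr_mult powr_powr by simp
      qed
      finally show ?thesis using in_box by (simp del: cbox_Pair_eq)
    qed
    then show ?thesis using True by (simp add: norm_mult del: cbox_Pair_eq)
  next
    case False
    then show ?thesis using c0 by (simp del: cbox_Pair_eq)
  qed
  have wint: "integrable lebesgue ?w"
  proof (rule Bochner_Integration.integrable_bound[OF gint wmeas], rule AE_I2)
    show "norm (?w z) \<le> norm (?g z)" for z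
      using order_trans[OF wg[of z] abs_ge_self] by (simp only: real_norm_def)
  qed
  have "mass p T u R + \<epsilon> * data_pairing u0 u1 R = Re (LINT z:?S|lebesgue. u z * damped_wave_op ?\<psi> z)"
    using arg_cong[OF eq[unfolded 1], of Re] by (simp add: data_pairing_def)
  also have "\<dots> = Re (LINT z|lebesgue. ?w z)"
    by (simp only: set_lebesgue_integral_def)
  also have "\<dots> \<le> norm (LINT z|lebesgue. ?w z)" by (rule complex_Re_le_cmod)
  also have "\<dots> \<le> (LINT z|lebesgue. ?g z)"
    by (rule Bochner_Integration.integral_norm_bound_integral[OF wint gint wg])
  also have "\<dots> = \<delta> * mass p T u R + ?c * measure lebesgue (supp_box :: (real \<times> 'a) set)"
    using int by (subst Bochner_Integration.integral_add)
      (use box_finite in \<open>auto simp: mass_def set_lebesgue_integral_def simp del: cbox_Pair_eq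
        intro!: integrable_mult_right integrable_real_indicator\<close>)
  finally show ?thesis unfolding measure_supp_box .
qed

end

lemma mass_test_fn_le:
  fixes u :: "real \<times> 'a::euclidean_space \<Rightarrow> complex"
  assumes u: "Lp_loc p T u" and R: "1 \<le> R" "ereal (R\<^sup>2) < T"
    and c: "\<And>z::real \<times> 'a. c * test_fn 1 z \<le> test_fn R z"
  shows "c * mass p T u 1 \<le> mass p T u R"
proof -
  have "1 \<le> R\<^sup>2" using R(1) by simp
  then have T1: "ereal (1\<^sup>2) < T" using R(2) by (simp add: le_less_trans[of _ "ereal (R\<^sup>2)"])
  have i: "integrable lebesgue (\<lambda>z. indicator (time_strip T) z *\<^sub>R (norm (u z) powr p * test_fn R' z))"
    if "0 < R'" "ereal (R'\<^sup>2) < T" for R'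
    using mass_integrable[OF that u] by (simp add: set_integrable_def)
  have "c * mass p T u 1 = (LINT z|lebesgue. c * (indicator (time_strip T) z *\<^sub>R (norm (u z) powr p * test_fn 1 z)))"
    by (simp add: mass_def set_lebesgue_integral_def)
  also have "\<dots> \<le> mass p T u R"
    unfolding mass_def set_lebesgue_integral_def
  proof (rule integral_mono)
    show "integrable lebesgue (\<lambda>z. c * (indicator (time_strip T) z *\<^sub>R (norm (u z) powr p * test_fn 1 z)))"
      using i[OF _ T1] by simp
    show "c * (indicator (time_strip T) z *\<^sub>R (norm (u z) powr p * test_fn 1 z))
        \<le> indicator (time_strip T) z *\<^sub>R (norm (u z) powr p * test_fn R z)" for z
      using mult_left_mono[OF c[of z], of "norm (u z) powr p"]
      by (simp add: indicator_def mult.left_commute)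
  qed (use R i in auto)
  finally show ?thesis .
qed

section \<open>Positivity of the data term\<close>

lemma
  fixes F :: "'a::euclidean_space \<Rightarrow> complex"
  assumes ft: "has_fourier_transform (\<lambda>x. u0 x + u1 x) F"
    and nonneg: "AE \<xi> in lebesgue. F \<xi> \<in> \<real> \<and> 0 \<le> Re (F \<xi>)"
  shows data_pairing_nonneg: "0 < R \<Longrightarrow> 0 \<le> data_pairing u0 u1 R"
    and data_pairing_pos: "0 < r \<Longrightarrow> AE \<xi> in lebesgue. \<xi> \<in> ball 0 r \<longrightarrow> 0 < Re (F \<xi>)
      \<Longrightarrow> 0 < data_pairing u0 u1 1"
proof -
  \<comment> \<open>The pairing formula turns the data term into a positive multiple of the integral
    of \<open>Re (F \<xi>)\<close> times \<open>cutoff_freq R \<xi>\<close>, a product of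
    nonnegative functions almost everywhere.\<close>
  define c where "c = (2 * pi) powr (- real DIM('a) / 2)"
  have c0: "0 < c" by (simp add: c_def)
  have main: "integrable lebesgue (\<lambda>\<xi>. Re (F \<xi>) * cutoff_freq R \<xi>)"
    "c * data_pairing u0 u1 R = cutoff 0 * (LINT \<xi>|lebesgue. Re (F \<xi>) * cutoff_freq R \<xi>)"
    if R: "0 < R" for R
  proof -
    obtain B where B: "\<And>\<xi>::'a. cutoff_freq R \<xi> \<le> B" using cutoff_freq_bounded[OF R] by blast
    \<comment> \<open>The norm is at most the sum of the n absolute coordinates, so beyond radius n
      R some coordinate exceeds R and its cutoff vanishes.\<close>
    have supp: "complex_of_real (cutoff_nd R x) = 0" if x: "real DIM('a) * R < norm x" for x :: 'a
    proof -
      have "\<exists>b\<in>Basis. R < \<bar>x \<bullet> b\<bar>"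
      proof (rule ccontr)
        assume "\<not> ?thesis"
        then have "(\<Sum>b\<in>Basis. \<bar>x \<bullet> b\<bar>) \<le> (\<Sum>b\<in>(Basis::'a set). R)" by (intro sum_mono) force
        then show False using x norm_le_l1[of x] by simp
      qed
      then obtain b where b: "b \<in> Basis" "R < \<bar>x \<bullet> b\<bar>" by blast
      then have "1 \<le> \<bar>x \<bullet> b / R\<bar>" using R by (simp add: abs_divide)
      then have "cutoff (x \<bullet> b / R) = 0" by (rule cutoff_eq_0)
      then show ?thesis using b(1) by (auto simp: cutoff_nd_def)
    qed
    note fp = fourier_pairing[OF ft cutoff_freq_integrable[OF R] cutoff_freq_nonneg[OF R] B cutoff_nd_eq_integral[OF R] supp]
    show "integrable lebesgue (\<lambda>\<xi>. Re (F \<xi>) * cutoff_freq R \<xi>)"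
      using integrable_Re[OF fp(1)] by simp
    have "(LINT \<xi>|lebesgue. Re (F \<xi>) * cutoff_freq R \<xi>) = Re (LINT \<xi>|lebesgue. F \<xi> * complex_of_real (cutoff_freq R \<xi>))"
    proof -
      have "(\<lambda>\<xi>. Re (F \<xi>) * cutoff_freq R \<xi>) = (\<lambda>\<xi>. Re (F \<xi> * complex_of_real (cutoff_freq R \<xi>)))"
        by auto
      then show ?thesis by (simp only: integral_Re[OF fp(1)])
    qed
    also have "(LINT \<xi>|lebesgue. F \<xi> * complex_of_real (cutoff_freq R \<xi>))
        = complex_of_real c * (LINT x|lebesgue. (u0 x + u1 x) * complex_of_real (cutoff_nd R x))"
      unfolding c_def by (rule fp(2))
    also have "Re \<dots> = c * Re (LINT x|lebesgue. (u0 x + u1 x) * complex_of_real (cutoff_nd R x))"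
      by simp
    finally have *: "(LINT \<xi>|lebesgue. Re (F \<xi>) * cutoff_freq R \<xi>)
      = c * Re (LINT x|lebesgue. (u0 x + u1 x) * complex_of_real (cutoff_nd R x))" .
    have "data_pairing u0 u1 R = Re (LINT x|lebesgue. complex_of_real (cutoff 0) * ((u0 x + u1 x) * complex_of_real (cutoff_nd R x)))"
      unfolding data_pairing_def test_fn_def by (simp add: mult_ac)
    also have "\<dots> = cutoff 0 * Re (LINT x|lebesgue. (u0 x + u1 x) * complex_of_real (cutoff_nd R x))"
      unfolding integral_mult_right_zero by simp
    finally show "c * data_pairing u0 u1 R = cutoff 0 * (LINT \<xi>|lebesgue. Re (F \<xi>) * cutoff_freq R \<xi>)"
      unfolding * by simp
  qed
  have ae: "AE \<xi> in lebesgue. 0 \<le> Re (F \<xi>) * cutoff_freq R \<xi>" if "0 < R" for R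
    using nonneg by eventually_elim (auto intro!: mult_nonneg_nonneg cutoff_freq_nonneg[OF that])
  show nn: "0 \<le> data_pairing u0 u1 R" if R: "0 < R" for R
  proof -
    have "0 \<le> c * data_pairing u0 u1 R"
      unfolding main(2)[OF R] using cutoff_0_pos by (intro mult_nonneg_nonneg integral_nonneg_AE[OF ae[OF R]]) auto
    then show ?thesis using c0 by (simp add: zero_le_mult_iff)
  qed
  show "0 < data_pairing u0 u1 1" if r: "0 < r" and pos: "AE \<xi> in lebesgue. \<xi> \<in> ball 0 r \<longrightarrow> 0 < Re (F \<xi>)"
  proof (rule ccontr)
    assume "\<not> 0 < data_pairing u0 u1 1"
    then have "data_pairing u0 u1 1 = 0" using nn[of 1] by simp
    then have "(LINT \<xi>|lebesgue. Re (F \<xi>) * cutoff_freq 1 \<xi>) = 0"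
      using main(2)[of 1] cutoff_0_pos by simp
    \<comment> \<open>Both factors are positive almost everywhere on the ball of radius min r 1, so
      that ball would be a null set.\<close>
    then have "AE \<xi> in lebesgue. Re (F \<xi>) * cutoff_freq 1 \<xi> = 0"
      using integral_nonneg_eq_0_iff_AE[OF main(1) ae] by simp
    with pos have "AE \<xi> in lebesgue. \<xi> \<notin> ball (0::'a) (min r 1)"
      by eventually_elim (use cutoff_freq_pos_near_0 in force)
    then have "AE \<xi> in lborel. \<xi> \<notin> ball (0::'a) (min r 1)"
      by (simp add: AE_completion_iff)
    then have "emeasure lborel (ball (0::'a) (min r 1)) = 0"
      by (subst (asm) AE_iff_measurable[of "ball 0 (min r 1)"]) auto
    then have "measure lborel (ball (0::'a) (min r 1)) = 0" by (simp add: measure_def)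
    moreover have "0 < measure lborel (ball (0::'a) (min r 1))"
      using r by (intro content_ball_pos) auto
    ultimately show False by simp
  qed
qed


section \<open>The lifespan estimate\<close>

text \<open>Chains the lower bound for the mass at scale 1, the comparison of scales and the upper
  bound at scale R. It is stated for times \<open>\<tau>\<close> below T, so T =
  \<open>\<infinity>\<close> is included; \<open>\<tau>0\<close> does not depend on
  \<open>\<epsilon>\<close>.\<close>

lemma lifespan_bound:
  fixes F :: "'a::euclidean_space \<Rightarrow> complex"
  assumes p: "1 < p" "p < 1 + 2 / real DIM('a)" "1 / p + 1 / p' = 1"
    and ft: "has_fourier_transform (\<lambda>x. u0 x + u1 x) F"
    and nonneg: "AE \<xi> in lebesgue. F \<xi> \<in> \<real> \<and> 0 \<le> Re (F \<xi>)"
    and pos: "0 < r" "AE \<xi> in lebesgue. \<xi> \<in> ball 0 r \<longrightarrow> 0 < Re (F \<xi>)"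
  obtains C \<tau>0 where "0 < C" "0 < \<tau>0"
    "\<And>\<epsilon> T u \<tau>. 0 < \<epsilon> \<Longrightarrow> weak_solution p \<epsilon> u0 u1 T u \<Longrightarrow> \<tau>0 \<le> \<tau> \<Longrightarrow> ereal \<tau> < T \<Longrightarrow>
      \<tau> \<le> C * \<epsilon> powr (- (p / (p' - 1 - real DIM('a) / 2)))"
    and "0 < p' - 1 - real DIM('a) / 2"
proof -
  define n where "n = real DIM('a)"
  \<comment> \<open>The error term scales like R to the power n + 2 - 2p', which is -2
    \<open>\<kappa>\<close>. Positivity of \<open>\<kappa>\<close> is exactly the subcritical
    condition p < 1 + 2/n.\<close>
  define \<kappa> where "\<kappa> = p' - 1 - n / 2"
  have n: "0 < n" by (simp add: n_def)
  have p'0: "p' \<noteq> 0" using p(1,3) by auto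
  have p'1: "p' - 1 = 1 / (p - 1)"
  proof -
    have "p + p' = p * p'" using p(1,3) p'0 by (simp add: field_simps)
    then have "(p' - 1) * (p - 1) = 1" by (simp add: algebra_simps)
    then show ?thesis using p(1) by (simp add: field_simps)
  qed
  have \<kappa>: "0 < \<kappa>"
  proof -
    have "n * (p - 1) < 2" using p(2) n by (simp add: n_def[symmetric] field_simps)
    then have "n / 2 < 1 / (p - 1)" using p(1) by (simp add: field_simps)
    then show ?thesis by (simp add: \<kappa>_def p'1)
  qed
  obtain B where B: "0 < B" "\<And>R (z :: real \<times> 'a). 1 \<le> R \<Longrightarrow>
      norm (damped_wave_op (\<lambda>z. complex_of_real (test_fn R z)) z) \<le> B / R\<^sup>2 * test_fn R z powr (1 / p)"
    using damped_wave_op_test_fn_bound[of "1 / p"] p(1) by auto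
  obtain c R0 where c: "0 < c" "1 \<le> R0"
      "\<And>R (z :: real \<times> 'a). R0 \<le> R \<Longrightarrow> c * test_fn 1 z \<le> test_fn R z"
    using test_fn_ge by blast
  define A where "A = B powr p' * 2 powr n"
  define Y where "Y = data_pairing u0 u1 1"
  have A: "0 < A" using B(1) by (simp add: A_def)
  have Y: "0 < Y" unfolding Y_def by (rule data_pairing_pos[OF ft nonneg pos])
  have ineq: "mass p T u R + \<epsilon> * data_pairing u0 u1 R
      \<le> \<delta> * mass p T u R + \<delta> powr (1 - p') * A * R powr (- 2 * \<kappa>)"
    if "weak_solution p \<epsilon> u0 u1 T u" "1 \<le> R" "ereal (R\<^sup>2) < T" "0 < \<delta>" for \<epsilon> T u R \<delta>
  proof -
    have R: "0 < R" using that(2) by simp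
    have "(B / R\<^sup>2) powr p' * (R\<^sup>2 * (2 * R) ^ DIM('a)) = A * R powr (- 2 * \<kappa>)"
    proof -
      have "(B / R\<^sup>2) powr p' = B powr p' * R powr (- 2 * p')"
        using B(1) R by (simp add: powr_divide powr_minus_divide powr_powr flip: powr_numeral)
      moreover have "R\<^sup>2 * (2 * R) ^ DIM('a) = 2 powr n * R powr (2 + n)"
        using R by (simp add: n_def powr_realpow[symmetric] powr_mult powr_add flip: powr_numeral)
      moreover have "R powr (- 2 * p') * R powr (2 + n) = R powr (- 2 * \<kappa>)"
        by (simp add: powr_add[symmetric] \<kappa>_def algebra_simps)
      ultimately show ?thesis by (simp add: A_def mult_ac)
    qed
    then show ?thesis
      using mass_inequality[OF R that(3,1) p(1,3) B(1) B(2)[OF that(2)] that(4)]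
      by (simp add: mult.assoc)
  qed
  define c1 where "c1 = Y / 2 * (Y / (2 * A)) powr (p - 1)"
  have c1: "0 < c1" using A Y by (simp add: c1_def)
  have lower: "c1 * \<epsilon> powr p \<le> mass p T u 1"
    if \<epsilon>: "0 < \<epsilon>" and w: "weak_solution p \<epsilon> u0 u1 T u" and T: "ereal (1\<^sup>2) < T" for \<epsilon> T u
  proof -
    \<comment> \<open>At R = 1 this choice makes the error equal to half of the data term
      \<open>\<epsilon> * Y\<close>. The other half is then bounded by \<open>\<delta>\<close> times
      the mass, and dividing by \<open>\<delta>\<close> raises the power of
      \<open>\<epsilon>\<close> from 1 to p.\<close>
    define \<delta> where "\<delta> = (2 * A / (\<epsilon> * Y)) powr (p - 1)"
    have \<delta>: "0 < \<delta>" using A Y \<epsilon> by (simp add: \<delta>_def)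
    have "(p - 1) * (1 - p') = - 1"
      using p'1 p(1) by (simp add: field_simps)
    then have "\<delta> powr (1 - p') = inverse (2 * A / (\<epsilon> * Y))"
      using A Y \<epsilon> by (simp add: \<delta>_def powr_powr powr_minus)
    then have "\<delta> powr (1 - p') * A = \<epsilon> * Y / 2"
      using A Y \<epsilon> by (simp add: field_simps)
    then have "mass p T u 1 + \<epsilon> * Y \<le> \<delta> * mass p T u 1 + \<epsilon> * Y / 2"
      using ineq[OF w _ T \<delta>] by (simp add: Y_def)
    moreover have "0 \<le> mass p T u 1" by (rule mass_nonneg[OF _ T]) simp
    ultimately have "\<epsilon> * Y / 2 \<le> \<delta> * mass p T u 1" by linarith
    then have "\<epsilon> * Y / 2 / \<delta> \<le> mass p T u 1"
      using \<delta> by (simp add: field_simps)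
    moreover have "\<epsilon> * Y / 2 / \<delta> = c1 * \<epsilon> powr p"
    proof -
      have "1 / \<delta> = (Y / (2 * A) * \<epsilon>) powr (p - 1)"
        using A Y \<epsilon> by (simp add: \<delta>_def powr_divide[symmetric] powr_minus_divide[symmetric] powr_divide field_simps powr_mult)
      also have "\<dots> = (Y / (2 * A)) powr (p - 1) * \<epsilon> powr (p - 1)"
        by (rule powr_mult)
      finally have inv: "1 / \<delta> = (Y / (2 * A)) powr (p - 1) * \<epsilon> powr (p - 1)" .
      have "\<epsilon> * Y / 2 / \<delta> = \<epsilon> * Y / 2 * (1 / \<delta>)" by simp
      also have "\<dots> = Y / 2 * (Y / (2 * A)) powr (p - 1) * (\<epsilon> powr 1 * \<epsilon> powr (p - 1))"
        unfolding inv using \<epsilon> by simp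
      finally have "\<epsilon> * Y / 2 / \<delta> = Y / 2 * (Y / (2 * A)) powr (p - 1) * (\<epsilon> powr 1 * \<epsilon> powr (p - 1))" .
      then show ?thesis by (simp only: powr_add[symmetric] c1_def) simp
    qed
    ultimately show ?thesis by simp
  qed
  have upper: "mass p T u R \<le> 2 powr p' * A * R powr (- 2 * \<kappa>)"
    if "0 < \<epsilon>" "weak_solution p \<epsilon> u0 u1 T u" "1 \<le> R" "ereal (R\<^sup>2) < T" for \<epsilon> T u R
  proof -
    have "0 \<le> \<epsilon> * data_pairing u0 u1 R"
      using that data_pairing_nonneg[OF ft nonneg, of R] by simp
    \<comment> \<open>With \<open>\<delta>\<close> = 1/2 half of the mass is absorbed on the left,
      and the nonnegative data term is dropped.\<close>
    then have "mass p T u R \<le> 2 * ((1/2) powr (1 - p') * A * R powr (- 2 * \<kappa>))"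
      using ineq[OF that(2-4), of "1/2"] by simp
    moreover have "2 * (1/2) powr (1 - p') = 2 powr p'"
      by (simp add: powr_divide powr_diff)
    ultimately show ?thesis by (simp add: mult.assoc[symmetric])
  qed
  \<comment> \<open>Comparing the two mass bounds gives \<open>c * c1 * \<epsilon> powr p\<close>
    \<le> \<open>2 powr p' * A * \<tau> powr (- \<kappa>)\<close>; \<open>D\<close> collects the
    constants.\<close>
  define D where "D = 2 powr p' * A / (c * c1)"
  have D: "0 < D" using A c(1) c1 by (simp add: D_def)
  show thesis
  proof (rule that[of "D powr (1 / \<kappa>)" "R0\<^sup>2"])
    show "0 < D powr (1 / \<kappa>)" "0 < R0\<^sup>2" using D c(2) by auto
    show "0 < p' - 1 - real DIM('a) / 2" using \<kappa> by (simp add: \<kappa>_def n_def)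
    fix \<epsilon> T \<tau> and u :: "real \<times> 'a \<Rightarrow> complex"
    assume \<epsilon>: "0 < \<epsilon>" and w: "weak_solution p \<epsilon> u0 u1 T u" and \<tau>: "R0\<^sup>2 \<le> \<tau>" "ereal \<tau> < T"
    \<comment> \<open>The largest scale controlled by \<open>\<tau>\<close>: the time support then
      ends by \<open>\<tau>\<close>, which is before T.\<close>
    define R where "R = sqrt \<tau>"
    have \<tau>1: "1 \<le> \<tau>" using \<tau>(1) one_le_power[OF c(2), of 2] by linarith
    have R: "R0 \<le> R" "R\<^sup>2 = \<tau>"
      using \<tau>(1) \<tau>1 by (auto simp: R_def real_le_rsqrt)
    then have R1: "1 \<le> R" "0 < R" using c(2) by auto
    have T: "ereal (R\<^sup>2) < T" "ereal (1\<^sup>2) < T"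
      using \<tau>(2) R(2) \<tau>1 by (auto intro: le_less_trans[of _ "ereal \<tau>"])
    have "c * (c1 * \<epsilon> powr p) \<le> c * mass p T u 1"
      using c(1) lower[OF \<epsilon> w T(2)] by simp
    also have "\<dots> \<le> mass p T u R"
      using w by (intro mass_test_fn_le[OF _ R1(1) T(1) c(3)[OF R(1)]]) (simp add: weak_solution_def)
    also have "\<dots> \<le> 2 powr p' * A * R powr (- 2 * \<kappa>)"
      by (rule upper[OF \<epsilon> w R1(1) T(1)])
    also have "R powr (- 2 * \<kappa>) = inverse (\<tau> powr \<kappa>)"
      using R1 by (simp add: R(2)[symmetric] powr_powr powr_minus flip: powr_numeral)
    finally have "\<tau> powr \<kappa> \<le> D * \<epsilon> powr (- p)"
      using c(1) c1 \<epsilon> \<tau>1 by (simp add: D_def powr_minus field_simps)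
    then have "(\<tau> powr \<kappa>) powr (1 / \<kappa>) \<le> (D * \<epsilon> powr (- p)) powr (1 / \<kappa>)"
      using \<kappa> by (intro powr_mono2) auto
    then show "\<tau> \<le> D powr (1 / \<kappa>) * \<epsilon> powr (- (p / (p' - 1 - real DIM('a) / 2)))"
      using \<kappa> D \<tau>1 \<epsilon> by (simp add: powr_powr powr_mult \<kappa>_def[symmetric] n_def[symmetric])
  qed
qed

theorem theorem3:
  fixes s \<gamma> p p' r :: real
    and u0 u1 F :: "real ^ 'n \<Rightarrow> complex"
  assumes "0 < s" "s \<le> 1" "0 < \<gamma>"
    and "1 < p" "p < 1 + 2 / real CARD('n)"
    and "1 / p + 1 / p' = 1"
    and "u0 \<in> sobolev s \<inter> L2_homogeneous_sobolev_neg \<gamma>"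
    and "u1 \<in> L2_homogeneous_sobolev_neg \<gamma>"
    and "has_fourier_transform (\<lambda>x. u0 x + u1 x) F"
    and "AE \<xi> in lebesgue. F \<xi> \<in> \<real> \<and> 0 \<le> Re (F \<xi>)"
    and "0 < r"
    and "AE \<xi> in lebesgue. \<xi> \<in> ball 0 r \<longrightarrow> 0 < Re (F \<xi>)"
  shows "(\<forall>\<^sub>F \<epsilon> in at_right 0. \<not> (\<exists>u. weak_solution p \<epsilon> u0 u1 \<infinity> u)) \<and>
    (\<exists>C>0. \<forall>\<^sub>F \<epsilon> in at_right 0. \<forall>T u. 0 < T \<and> weak_solution p \<epsilon> u0 u1 T u \<longrightarrow>
       T \<le> ereal (C * \<epsilon> powr (- (p / (p' - 1 - real CARD('n) / 2)))))"
proof -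
  define a where "a = p / (p' - 1 - real CARD('n) / 2)"
  have dim: "real DIM(real ^ 'n) = real CARD('n)" by simp
  obtain C \<tau>0 where C: "0 < C" "0 < \<tau>0"
    and bound: "\<And>\<epsilon> T u \<tau>. 0 < \<epsilon> \<Longrightarrow> weak_solution p \<epsilon> u0 u1 T u \<Longrightarrow> \<tau>0 \<le> \<tau> \<Longrightarrow> ereal \<tau> < T \<Longrightarrow>
      \<tau> \<le> C * \<epsilon> powr (- a)"
    and pos: "0 < p' - 1 - real CARD('n) / 2"
    using lifespan_bound[OF assms(4) _ assms(6,9,10,11,12), unfolded dim, OF assms(5), folded a_def] by blast
  have a: "0 < a" using pos assms(4) by (simp add: a_def)
  \<comment> \<open>For \<open>\<epsilon>\<close> below \<open>e\<close> the claimed bound is at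
    least \<open>\<tau>0\<close>, so every time beyond it lies in the range of the estimate.\<close>
  define e where "e = (\<tau>0 / C) powr (- 1 / a)"
  have e: "0 < e" using C by (simp add: e_def)
  have lifespan: "T \<le> ereal (C * \<epsilon> powr (- a))"
    if \<epsilon>: "0 < \<epsilon>" "\<epsilon> < e" and w: "weak_solution p \<epsilon> u0 u1 T u" for \<epsilon> T u
  proof (rule ccontr)
    assume "\<not> ?thesis"
    then have "ereal (C * \<epsilon> powr (- a)) < T" by simp
    \<comment> \<open>A real time strictly between the bound and T exists also when T is
      infinite.\<close>
    then obtain \<tau> where \<tau>: "ereal (C * \<epsilon> powr (- a)) < ereal \<tau>" "ereal \<tau> < T"
      using ereal_dense2 by blast
    have "e powr (- a) \<le> \<epsilon> powr (- a)"
      using \<epsilon> a by (intro powr_mono2') auto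
    moreover have "e powr (- a) = \<tau>0 / C"
      using a C by (simp add: e_def powr_powr)
    ultimately have "\<tau>0 \<le> C * \<epsilon> powr (- a)"
      using C by (simp add: field_simps)
    then have "\<tau> \<le> C * \<epsilon> powr (- a)"
      using \<tau> by (intro bound[OF \<epsilon>(1) w _ \<tau>(2)]) auto
    then show False using \<tau>(1) by simp
  qed
  have small: "\<forall>\<^sub>F \<epsilon> in at_right 0. 0 < \<epsilon> \<and> \<epsilon> < e"
    using e by (intro eventually_at_rightI[of 0 e]) auto
  \<comment> \<open>A global solution would make \<open>\<infinity>\<close> at most a real number in
    the lifespan estimate.\<close>
  have "\<forall>\<^sub>F \<epsilon> in at_right 0. \<not> (\<exists>u. weak_solution p \<epsilon> u0 u1 \<infinity> u)"
    using small by eventually_elim (use lifespan in force)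
  moreover have "\<forall>\<^sub>F \<epsilon> in at_right 0. \<forall>T u. 0 < T \<and> weak_solution p \<epsilon> u0 u1 T u \<longrightarrow>
       T \<le> ereal (C * \<epsilon> powr (- a))"
    using small by eventually_elim (use lifespan in blast)
  ultimately show ?thesis
    using C(1) unfolding a_def by blast
qed

end
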